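(* 1-player motion planning with any $k$-tunnel gadget that does not have interacting tunnels is in NL.
   Context: A gadget consists of finitely many locations and finitely many states; each state $s$ has a set of transitions $(a,b,s')$ meaning a robot may enter at location $a$, exit at location $b$, and the gadget's state changes to $s'$. A $k$-tunnel gadget has $2k$ locations partitioned into $k$ pairs called tunnels, and every transition in every state goes between the two locations of one tunnel (so each state specifies in which direction(s) each tunnel can be traversed). The gadget has interacting tunnels if there is a state $s$ and a transition across some tunnel from $s$ to a state $s'$ such that the set of allowed traversal directions of some other tunnel differs between $s$ and $s'$. A system of gadgets consists of copies of gadgets, their initial states, and a connection graph on their locations; a robot can move freely between locations connected by a path in the connection graph, and can traverse a gadget according to its current state (changing only that gadget's state). In 1-player motion planning with a gadget $G$, the input is a system of copies of $G$ with a start and a goal location, and the question is whether the robot can reach the goal from the start. *)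

theory Defs
  imports Complex_Main "HOL-Library.Landau_Symbols" "HOL-Library.Disjoint_Sets"
begin

section \<open>Nondeterministic space-bounded Turing machines\<close>

text \<open>
  The machines have a two-way read-only input tape, on which the input word is enclosed between
  two end markers, and a fixed number of read-write work tapes that are infinite to the right.
  Machine states and work symbols are natural numbers; only finitely many of them matter, because
  the transition table is finite. Symbol 0 is the blank.
\<close>

datatype 'a input_cell = Left_End | Sym 'a | Right_End

datatype move = Go_Left | Stay | Go_Right

record 'a ntm =
  work_tapes :: nat
  start_state :: nat
  accept_state :: nat
  \<comment> \<open>current state, scanned input cell, scanned work symbols,
      next state, input head move, symbol written and head move for each work tape\<close>
  table :: "(nat \<times> 'a input_cell \<times> nat list \<times> nat \<times> move \<times> (nat \<times> move) list) set"

definition wf_ntm :: "'a ntm \<Rightarrow> bool" where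
  "wf_ntm M \<longleftrightarrow> finite (table M) \<and>
     (\<forall>(q, a, us, q', d, acts) \<in> table M.
        length us = work_tapes M \<and> length acts = work_tapes M)"

type_synonym work_tape = "(nat \<Rightarrow> nat) \<times> nat"

type_synonym ntm_config = "nat \<times> nat \<times> work_tape list"

definition input_cell :: "'a list \<Rightarrow> nat \<Rightarrow> 'a input_cell" where
  "input_cell x i =
     (if i = 0 then Left_End else if i \<le> length x then Sym (x ! (i - 1)) else Right_End)"

text \<open>A head at the left end of its tape stays where it is when told to move left.\<close>

fun move_head :: "move \<Rightarrow> nat \<Rightarrow> nat" where
  "move_head Go_Left h = h - 1"
| "move_head Stay h = h"
| "move_head Go_Right h = h + 1"

fun scanned :: "work_tape \<Rightarrow> nat" where
  "scanned (t, h) = t h"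

fun act_on :: "work_tape \<Rightarrow> nat \<times> move \<Rightarrow> work_tape" where
  "act_on (t, h) (u, d) = (t(h := u), move_head d h)"

definition ntm_init :: "'a ntm \<Rightarrow> ntm_config" where
  "ntm_init M = (start_state M, 0, replicate (work_tapes M) (\<lambda>_. 0, 0))"

text \<open>The input head never leaves the cells 0 to \<open>length x + 1\<close>.\<close>

inductive ntm_step :: "'a ntm \<Rightarrow> 'a list \<Rightarrow> ntm_config \<Rightarrow> ntm_config \<Rightarrow> bool"
  for M :: "'a ntm" and x :: "'a list" where
  "(q, input_cell x i, map scanned ws, q', d, acts) \<in> table M \<Longrightarrow>
   ntm_step M x (q, i, ws)
     (q', min (move_head d i) (length x + 1), map2 act_on ws acts)"

definition ntm_reachable :: "'a ntm \<Rightarrow> 'a list \<Rightarrow> ntm_config \<Rightarrow> bool" where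
  "ntm_reachable M x c \<longleftrightarrow> (ntm_step M x)\<^sup>*\<^sup>* (ntm_init M) c"

definition accepts :: "'a ntm \<Rightarrow> 'a list \<Rightarrow> bool" where
  "accepts M x \<longleftrightarrow> (\<exists>i ws. ntm_reachable M x (accept_state M, i, ws))"

text \<open>
  Heads start in cell 0 and move by at most one cell, so the largest head position bounds the number
  of cells visited. The input tape is not counted, and the bound is required of every
  nondeterministic computation, accepting or not.
\<close>

definition uses_space :: "'a ntm \<Rightarrow> (nat \<Rightarrow> nat) \<Rightarrow> bool" where
  "uses_space M f \<longleftrightarrow>
     (\<forall>x q i ws. ntm_reachable M x (q, i, ws) \<longrightarrow> (\<forall>(t, h) \<in> set ws. h < f (length x)))"

definition NSPACE :: "(nat \<Rightarrow> real) \<Rightarrow> 'a::finite list set set" where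
  "NSPACE s = {A. \<exists>(M :: 'a ntm) f. wf_ntm M \<and> (\<lambda>n. real (f n)) \<in> O(s) \<and> uses_space M f \<and>
                     (\<forall>x. x \<in> A \<longleftrightarrow> accepts M x)}"

definition NL :: "'a::finite list set set" where
  "NL = NSPACE (\<lambda>n. log 2 (real n))"


section \<open>Gadgets\<close>

text \<open>
  The locations are the elements of the finite type \<open>'l\<close>, the states those of the finite type
  \<open>'s\<close>. A gadget maps each state to its set of transitions (entrance, exit, new state).
\<close>

type_synonym ('l, 's) gadget = "'s \<Rightarrow> ('l \<times> 'l \<times> 's) set"

definition tunnel_gadget :: "nat \<Rightarrow> 'l set set \<Rightarrow> ('l::finite, 's::finite) gadget \<Rightarrow> bool" where
  "tunnel_gadget k P G \<longleftrightarrow>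
     partition_on UNIV P \<and> card P = k \<and> (\<forall>T \<in> P. card T = 2) \<and>
     (\<forall>s a b s'. (a, b, s') \<in> G s \<longrightarrow> {a, b} \<in> P)"

definition directions :: "('l, 's) gadget \<Rightarrow> 's \<Rightarrow> 'l set \<Rightarrow> ('l \<times> 'l) set" where
  "directions G s T = {(a, b). {a, b} = T \<and> (\<exists>s'. (a, b, s') \<in> G s)}"

definition interacting_tunnels :: "'l set set \<Rightarrow> ('l, 's) gadget \<Rightarrow> bool" where
  "interacting_tunnels P G \<longleftrightarrow>
     (\<exists>s a b s'. (a, b, s') \<in> G s \<and>
        (\<exists>T \<in> P. T \<noteq> {a, b} \<and> directions G s T \<noteq> directions G s' T))"


section \<open>1-player motion planning\<close>

text \<open>
  The location \<open>a\<close> of the \<open>i\<close>-th copy (counting from 0) is the pair \<open>(i, a)\<close>. The connection graph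
  is undirected and given by a list of edges.
\<close>

record ('l, 's) system =
  initial_states :: "'s list"
  connections :: "((nat \<times> 'l) \<times> (nat \<times> 'l)) list"
  start_loc :: "nat \<times> 'l"
  goal_loc :: "nat \<times> 'l"

definition system_locs :: "('l, 's) system \<Rightarrow> (nat \<times> 'l) set" where
  "system_locs S = {..<length (initial_states S)} \<times> UNIV"

definition wf_system :: "('l, 's) system \<Rightarrow> bool" where
  "wf_system S \<longleftrightarrow> set (connections S) \<subseteq> system_locs S \<times> system_locs S \<and>
     start_loc S \<in> system_locs S \<and> goal_loc S \<in> system_locs S"

definition connected_by_path :: "('l, 's) system \<Rightarrow> ((nat \<times> 'l) \<times> (nat \<times> 'l)) set" where
  "connected_by_path S = (set (connections S) \<union> (set (connections S))\<inverse>)\<^sup>*"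

inductive robot_step ::
  "('l, 's) gadget \<Rightarrow> ('l, 's) system \<Rightarrow>
   (nat \<times> 'l) \<times> 's list \<Rightarrow> (nat \<times> 'l) \<times> 's list \<Rightarrow> bool"
  for G :: "('l, 's) gadget" and S :: "('l, 's) system" where
  walk: "(p, q) \<in> connected_by_path S \<Longrightarrow> robot_step G S (p, ss) (q, ss)"
| traverse: "i < length ss \<Longrightarrow> (a, b, s') \<in> G (ss ! i) \<Longrightarrow>
    robot_step G S ((i, a), ss) ((i, b), ss[i := s'])"

definition solvable :: "('l, 's) gadget \<Rightarrow> ('l, 's) system \<Rightarrow> bool" where
  "solvable G S \<longleftrightarrow>
     (\<exists>ss. (robot_step G S)\<^sup>*\<^sup>* (start_loc S, initial_states S) (goal_loc S, ss))"

text \<open>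
  Instances are words over an alphabet that is finite because the gadget is fixed: the initial
  states in order, then the start, the goal, and the two endpoints of every connection, where
  \<open>(i, a)\<close> is written as \<open>i\<close> in binary followed by \<open>a\<close>. No separators are needed, since
  every location ends in a symbol \<open>Loc a\<close>.
\<close>

datatype ('l, 's) letter = State 's | Bit bool | Loc 'l

instance letter :: (finite, finite) finite
proof
  have "(UNIV :: ('a, 'b) letter set) = range State \<union> range Bit \<union> range Loc"
    by (metis (no_types, lifting) UNIV_eq_I UnCI letter.exhaust rangeI)
  then show "finite (UNIV :: ('a, 'b) letter set)"
    by (metis finite_Un finite_imageI finite)
qed

text \<open>Least significant bit first, without superfluous zeros; the number 0 is the empty word.\<close>

fun binary :: "nat \<Rightarrow> bool list" where
  "binary n = (if n = 0 then [] else odd n # binary (n div 2))"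

declare binary.simps [simp del]

fun encode_loc :: "nat \<times> 'l \<Rightarrow> ('l, 's) letter list" where
  "encode_loc (i, a) = map Bit (binary i) @ [Loc a]"

definition encode :: "('l, 's) system \<Rightarrow> ('l, 's) letter list" where
  "encode S = map State (initial_states S) @ encode_loc (start_loc S) @ encode_loc (goal_loc S) @
     concat (map (\<lambda>(p, q). encode_loc p @ encode_loc q) (connections S))"

lemma binary_inject: "binary m = binary n \<longleftrightarrow> m = n"
proof (induction m arbitrary: n rule: less_induct)
  case (less m)
  show ?case
  proof (cases "m = 0 \<or> n = 0")
    case True
    then show ?thesis
      by (metis binary.simps list.distinct(1))
  next
    case False
    then have "binary m = binary n \<longleftrightarrow> odd m = odd n \<and> m div 2 = n div 2"
      using less[of "m div 2" "n div 2"] by (simp add: binary.simps[of m] binary.simps[of n])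
    also have "\<dots> \<longleftrightarrow> m = n"
      by (metis div_mult_mod_eq even_iff_mod_2_eq_zero odd_iff_mod_2_eq_one)
    finally show ?thesis .
  qed
qed

lemma map_append_unique:
  assumes "map f xs @ y # ys = map f xs' @ y' # ys'" "inj f" "y \<notin> range f" "y' \<notin> range f"
  shows "xs = xs' \<and> y = y' \<and> ys = ys'"
  using assms
proof (induction xs arbitrary: xs')
  case Nil
  then show ?case by (cases xs') auto
next
  case (Cons x xs)
  then show ?case by (cases xs') (auto dest: injD)
qed

lemma encode_loc_append_inject:
  "encode_loc p @ u = encode_loc q @ v \<longleftrightarrow> p = q \<and> u = v"
proof
  assume *: "encode_loc p @ u = encode_loc q @ v"
  obtain i a j b where pq: "p = (i, a)" "q = (j, b)" by (metis surj_pair)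
  show "p = q \<and> u = v"
    using map_append_unique[of Bit "binary i" "Loc a" u "binary j" "Loc b" v] *
    by (auto simp: pq binary_inject inj_def)
qed simp

lemma encode_loc_not_State: "\<exists>y ys. encode_loc p @ u = y # ys \<and> y \<notin> range State"
  by (cases p; cases "binary (fst p)") auto

text \<open>The encoding is unambiguous.\<close>

lemma inj_encode: "inj encode"
proof (rule injI)
  fix S S' :: "('l, 's) system"
  let ?c = "\<lambda>es. concat (map (\<lambda>(p, q). encode_loc p @ encode_loc q) es) :: ('l, 's) letter list"
  let ?r = "\<lambda>S. encode_loc (start_loc S) @ encode_loc (goal_loc S) @ ?c (connections S)"
  assume eq: "encode S = encode S'"
  obtain y ys y' ys' where "?r S = y # ys" "y \<notin> range State" "?r S' = y' # ys'" "y' \<notin> range State"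
    by (metis encode_loc_not_State)
  then have *: "initial_states S = initial_states S' \<and> ?r S = ?r S'"
    using map_append_unique[of State "initial_states S" y ys "initial_states S'" y' ys'] eq
    by (simp add: encode_def inj_def)
  have ne: "encode_loc p \<noteq> ([] :: ('l, 's) letter list)" for p :: "nat \<times> 'l"
    by (cases p) simp
  have "es = es'" if "?c es = ?c es'" for es es'
    using that
  proof (induction es arbitrary: es')
    case Nil
    then show ?case by (cases es') (auto simp: ne simp del: encode_loc.simps)
  next
    case (Cons e es)
    obtain p q where e: "e = (p, q)" by (cases e)
    show ?case
    proof (cases es')
      case Nil
      with Cons.prems show ?thesis by (simp add: e ne del: encode_loc.simps)
    next
      case es': (Cons e' fs)
      obtain p' q' where e': "e' = (p', q')" by (cases e')
      have "p = p' \<and> q = q' \<and> ?c es = ?c fs"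
        using Cons.prems
        by (simp add: e e' es' encode_loc_append_inject del: encode_loc.simps)
      then show ?thesis
        using Cons.IH[of fs] by (simp add: e e' es')
    qed
  qed
  with * show "S = S'"
    by (simp add: encode_loc_append_inject del: encode_loc.simps)
qed

definition motion_planning :: "('l::finite, 's::finite) gadget \<Rightarrow> ('l, 's) letter list set" where
  "motion_planning G = {encode S | S. wf_system S \<and> solvable G S}"

end

(*
  Without interacting tunnels, a traversal changes the directions of the traversed tunnel only.
  Hence the robot reaches a location iff it does so in the static graph formed by the connections
  and the traversals allowed in the initial states: when a tunnel is first used its directions are
  still the initial ones, and afterwards both of its ends are already known to be reachable.

  Static reachability is decided by a machine that stores, least significant bit first, the number
  of gadgets, the index of the gadget at which the robot stands, and an auxiliary number on three
  tracks of one work tape. The first pass over the State letters counts the gadgets, which fixes the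
  width of the tape. Every pass reads all locations, rejecting malformed or out-of-range ones, and
  may move the robot through a tunnel and along connections; a pass that finds the robot at the goal
  accepts at the end of the input.
*)

theory Submission
  imports Defs
begin

section \<open>Static reachability\<close>

text \<open>The robot carries an index, while its gadget has to be found by position among the State
  letters. Keeping the complement of the current index on the auxiliary track turns this search into
  incrementing: the counter overflows exactly at the gadget of the robot, so no further index and no
  equality test are needed. Storing a location overwrites that track, which is why the complement is
  rebuilt once the stored index has served.

  Whether a location is compared or stored is guessed before it is read. Only a claimed match is
  checked, since overlooking a match merely wastes a pass.

  Two demands shape the invariant: the space bound concerns every computation on every word, and an
  accepted word must encode a well-formed system. So the invariant is stated for arbitrary input,
  with claims on reachability conditional on a decoding. The width of the tape after the count is
  exactly the binary length of the number of gadgets, which gives logarithmic space and still holds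
  every index in range.\<close>

definition static_edges :: "('l, 's) gadget \<Rightarrow> ('l, 's) system \<Rightarrow> ((nat \<times> 'l) \<times> (nat \<times> 'l)) set" where
  "static_edges G S = set (connections S) \<union> (set (connections S))\<inverse> \<union>
     {((i, a), (i, b)) | i a b s'. i < length (initial_states S) \<and> (a, b, s') \<in> G (initial_states S ! i)}"

definition static_reach :: "('l, 's) gadget \<Rightarrow> ('l, 's) system \<Rightarrow> nat \<times> 'l \<Rightarrow> bool" where
  "static_reach G S p \<longleftrightarrow> (start_loc S, p) \<in> (static_edges G S)\<^sup>*"

lemma directions_non_interacting:
  assumes "\<not> interacting_tunnels P G" "(a, b, s') \<in> G s" "T \<in> P" "T \<noteq> {a, b}"
  shows "directions G s' T = directions G s T"
  using assms unfolding interacting_tunnels_def by metis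

lemma solvable_imp_static_reach:
  assumes "tunnel_gadget k P G" "\<not> interacting_tunnels P G" "solvable G S"
  shows "static_reach G S (goal_loc S)"
proof -
  \<comment> \<open>Only tunnels with a statically unreachable end must keep their initial
    directions. A traversal into an unreachable end would use such a tunnel and hence a static edge,
    which is absurd; so traversed tunnels are never among them.\<close>
  define I where "I = (\<lambda>(p, ss). static_reach G S p \<and> length ss = length (initial_states S) \<and>
    (\<forall>i < length ss. \<forall>T \<in> P. (\<exists>a \<in> T. \<not> static_reach G S (i, a)) \<longrightarrow>
       directions G (ss ! i) T = directions G (initial_states S ! i) T))"
  have step: "I d" if "robot_step G S c d" "I c" for c d
    using that
  proof cases
    case (walk p q ss)
    have "connected_by_path S \<subseteq> (static_edges G S)\<^sup>*"
      unfolding connected_by_path_def static_edges_def by (intro rtrancl_mono) auto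
    then have "(p, q) \<in> (static_edges G S)\<^sup>*" using walk by auto
    then show ?thesis
      using walk that(2) unfolding I_def static_reach_def by (auto intro: rtrancl_trans)
  next
    case (traverse i ss a b s')
    have T: "{a, b} \<in> P" using assms(1) traverse(4) unfolding tunnel_gadget_def by blast
    have I: "static_reach G S (i, a)" "length ss = length (initial_states S)"
      "\<And>j T c. j < length ss \<Longrightarrow> T \<in> P \<Longrightarrow> c \<in> T \<Longrightarrow> \<not> static_reach G S (j, c) \<Longrightarrow>
         directions G (ss ! j) T = directions G (initial_states S ! j) T"
      using that(2) unfolding I_def traverse(1) prod.case by blast+
    have b: "static_reach G S (i, b)"
    proof (rule ccontr)
      assume nb: "\<not> static_reach G S (i, b)"
      have "(a, b) \<in> directions G (ss ! i) {a, b}" using traverse(4) unfolding directions_def by blast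
      then have "(a, b) \<in> directions G (initial_states S ! i) {a, b}" using I(3)[OF traverse(3) T _ nb] by simp
      then have "((i, a), (i, b)) \<in> static_edges G S"
        using traverse(3) I(2) unfolding directions_def static_edges_def by auto
      then show False using nb I(1) unfolding static_reach_def by (meson rtrancl.rtrancl_into_rtrancl)
    qed
    have "directions G (ss[i := s'] ! j) T = directions G (initial_states S ! j) T"
      if "j < length ss" "T \<in> P" "c \<in> T" "\<not> static_reach G S (j, c)" for j T c
    proof -
      have "directions G (ss ! j) T = directions G (initial_states S ! j) T"
        using I(3) that by blast
      moreover have "directions G s' T = directions G (ss ! i) T" if "j = i"
        using directions_non_interacting[OF assms(2) traverse(4) \<open>T \<in> P\<close>] that b I(1)
          \<open>c \<in> T\<close> \<open>\<not> static_reach G S (j, c)\<close> by blast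
      ultimately show ?thesis using that(1) by (cases "j = i") auto
    qed
    then show ?thesis using b I(2) traverse(2) unfolding I_def by auto
  qed
  have init: "I (start_loc S, initial_states S)"
    unfolding I_def static_reach_def by auto
  have "I d" if "(robot_step G S)\<^sup>*\<^sup>* (start_loc S, initial_states S) d" for d
    using that by (induction rule: rtranclp_induct) (rule init, rule step)
  then show ?thesis using assms(3) unfolding solvable_def I_def by fastforce
qed

text \<open>Along a shortest path every tunnel is entered before the robot has seen its other end.\<close>

lemma static_path_robot:
  assumes "tunnel_gadget k P G" "\<not> interacting_tunnels P G"
    and "(start_loc S, p) \<in> static_edges G S ^^ n"
    and "\<forall>j < n. (start_loc S, p) \<notin> static_edges G S ^^ j"
  shows "\<exists>ss. (robot_step G S)\<^sup>*\<^sup>* (start_loc S, initial_states S) (p, ss) \<and>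
     length ss = length (initial_states S) \<and>
     (\<forall>i < length ss. \<forall>T \<in> P. (\<exists>a \<in> T. \<forall>j \<le> n. (start_loc S, (i, a)) \<notin> static_edges G S ^^ j) \<longrightarrow>
        directions G (ss ! i) T = directions G (initial_states S ! i) T)"
  using assms(3,4)
proof (induction n arbitrary: p)
  case 0
  then show ?case by auto
next
  case (Suc n)
  let ?E = "static_edges G S"
  obtain q where q: "(start_loc S, q) \<in> ?E ^^ n" "(q, p) \<in> ?E" using Suc.prems(1) by auto
  have "\<forall>j < n. (start_loc S, q) \<notin> ?E ^^ j"
  proof (intro allI impI notI)
    fix j assume "j < n" "(start_loc S, q) \<in> ?E ^^ j"
    then have "(start_loc S, p) \<in> ?E ^^ Suc j" using q(2) relpow_Suc_I by metis
    then show False using Suc.prems(2) \<open>j < n\<close> by blast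
  qed
  then obtain ss where ss: "(robot_step G S)\<^sup>*\<^sup>* (start_loc S, initial_states S) (q, ss)"
     "length ss = length (initial_states S)"
     "\<And>i T a. i < length ss \<Longrightarrow> T \<in> P \<Longrightarrow> a \<in> T \<Longrightarrow> \<forall>j \<le> n. (start_loc S, (i, a)) \<notin> ?E ^^ j \<Longrightarrow>
        directions G (ss ! i) T = directions G (initial_states S ! i) T"
    using Suc.IH[OF q(1)] by blast
  consider "(q, p) \<in> set (connections S) \<union> (set (connections S))\<inverse>"
    | i a b s' where "q = (i, a)" "p = (i, b)" "i < length (initial_states S)"
        "(a, b, s') \<in> G (initial_states S ! i)"
    using q(2) unfolding static_edges_def by blast
  then show ?case
  proof cases
    case 1
    then have "(q, p) \<in> connected_by_path S" unfolding connected_by_path_def by auto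
    then have "(robot_step G S)\<^sup>*\<^sup>* (start_loc S, initial_states S) (p, ss)"
      using ss(1) robot_step.walk by (meson rtranclp.rtrancl_into_rtrancl)
    then show ?thesis using ss(2,3) by (metis le_SucI)
  next
    case 2
    have T: "{a, b} \<in> P" using assms(1) 2 unfolding tunnel_gadget_def by blast
    \<comment> \<open>No walk of at most \<open>n\<close> edges leads to \<open>p\<close>, so the
      far end \<open>b\<close> puts this tunnel among those that still have their initial
      directions.\<close>
    have "directions G (ss ! i) {a, b} = directions G (initial_states S ! i) {a, b}"
      using ss(2) ss(3)[OF _ T, of i b] 2 Suc.prems(2) by auto
    moreover have "(a, b) \<in> directions G (initial_states S ! i) {a, b}"
      using 2 unfolding directions_def by auto
    ultimately have "(a, b) \<in> directions G (ss ! i) {a, b}" by simp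
    then obtain s where s: "(a, b, s) \<in> G (ss ! i)" unfolding directions_def by auto
    have "robot_step G S (q, ss) (p, ss[i := s])"
      using robot_step.traverse[of i ss a b s G S] s 2 ss(2) by simp
    then have R: "(robot_step G S)\<^sup>*\<^sup>* (start_loc S, initial_states S) (p, ss[i := s])"
      using ss(1) by simp
    have "directions G (ss[i := s] ! j) T = directions G (initial_states S ! j) T"
      if "j < length ss" "T \<in> P" "c \<in> T" "\<forall>m \<le> Suc n. (start_loc S, (j, c)) \<notin> ?E ^^ m" for j T c
    proof -
      have "directions G (ss ! j) T = directions G (initial_states S ! j) T"
        using ss(3) that by auto
      moreover have "directions G s T = directions G (ss ! i) T" if "j = i"
      proof -
        \<comment> \<open>\<open>a\<close> is reached by \<open>n\<close> edges and \<open>b\<close>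
          by \<open>Suc n\<close>, but \<open>c\<close> by neither number; so \<open>T\<close> is
          not the tunnel just traversed.\<close>
        have "c \<noteq> a" "c \<noteq> b"
          using \<open>\<forall>m \<le> Suc n. _\<close> that 2 q(1) Suc.prems(1) le_SucI by blast+
        then show ?thesis
          using directions_non_interacting[OF assms(2) s \<open>T \<in> P\<close>] \<open>c \<in> T\<close> by blast
      qed
      ultimately show ?thesis using that(1) by (cases "j = i") auto
    qed
    then show ?thesis using R ss(2) by (intro exI[of _ "ss[i := s]"]) auto
  qed
qed

lemma static_reach_imp_solvable:
  assumes "tunnel_gadget k P G" "\<not> interacting_tunnels P G" "static_reach G S (goal_loc S)"
  shows "solvable G S"
proof -
  let ?R = "\<lambda>n. (start_loc S, goal_loc S) \<in> static_edges G S ^^ n"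
  obtain n where n: "?R n" using assms(3) unfolding static_reach_def by (auto dest: rtrancl_imp_relpow)
  show ?thesis
    using static_path_robot[OF assms(1,2) LeastI[of ?R, OF n]] not_less_Least[of _ ?R]
    unfolding solvable_def by blast
qed

section \<open>Machines with one work tape\<close>

type_synonym ('a, 'q, 'g) trans =
  "'q \<Rightarrow> 'a input_cell \<Rightarrow> 'g \<Rightarrow> 'q \<Rightarrow> move \<Rightarrow> 'g \<Rightarrow> move \<Rightarrow> bool"

inductive step1 :: "('a, 'q, 'g) trans \<Rightarrow> 'a list \<Rightarrow>
    'q \<times> nat \<times> (nat \<Rightarrow> 'g) \<times> nat \<Rightarrow> 'q \<times> nat \<times> (nat \<Rightarrow> 'g) \<times> nat \<Rightarrow> bool"
  for T :: "('a, 'q, 'g) trans" and x :: "'a list" where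
  step1I: "T q (input_cell x i) (t h) q' d u e \<Longrightarrow>
    step1 T x (q, i, t, h) (q', min (move_head d i) (length x + 1), t(h := u), move_head e h)"

definition to_ntm :: "('q \<Rightarrow> nat) \<Rightarrow> ('g \<Rightarrow> nat) \<Rightarrow> ('a, 'q, 'g) trans \<Rightarrow> 'q \<Rightarrow> 'q \<Rightarrow> 'a ntm" where
  "to_ntm f g T q0 qa = \<lparr>work_tapes = 1, start_state = f q0, accept_state = f qa,
     table = {(f q, c, [g u], f q', d, [(g u', e)]) | q c u q' d u' e. T q c u q' d u' e}\<rparr>"

fun ntm_conf :: "('q \<Rightarrow> nat) \<Rightarrow> ('g \<Rightarrow> nat) \<Rightarrow> 'q \<times> nat \<times> (nat \<Rightarrow> 'g) \<times> nat \<Rightarrow> ntm_config" where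
  "ntm_conf f g (q, i, t, h) = (f q, i, [(g \<circ> t, h)])"

text \<open>Injective codings make every table entry uniquely decodable, so no step of the coded
  machine leaves the image of \<open>ntm_conf\<close>.\<close>

lemma ntm_step_to_ntm:
  assumes "inj f" "inj g"
  shows "ntm_step (to_ntm f g T q0 qa) x (ntm_conf f g c) d \<longleftrightarrow>
    (\<exists>c'. d = ntm_conf f g c' \<and> step1 T x c c')"
proof -
  obtain q i t h where c: "c = (q, i, t, h)" by (metis surj_pair)
  show ?thesis
  proof
    assume "ntm_step (to_ntm f g T q0 qa) x (ntm_conf f g c) d"
    then obtain q' dd acts where d: "d = (q', min (move_head dd i) (length x + 1), map2 act_on [(g \<circ> t, h)] acts)"
      and "(f q, input_cell x i, [g (t h)], q', dd, acts) \<in> table (to_ntm f g T q0 qa)"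
      unfolding c by (auto elim!: ntm_step.cases)
    then obtain q'' u' e where "T q (input_cell x i) (t h) q'' dd u' e" "q' = f q''" "acts = [(g u', e)]"
      using assms by (auto simp: to_ntm_def inj_eq)
    then show "\<exists>c'. d = ntm_conf f g c' \<and> step1 T x c c'"
      using step1I[of T q x i t h q'' dd u' e]
      by (intro exI[of _ "(q'', min (move_head dd i) (length x + 1), t(h := u'), move_head e h)"])
        (auto simp: c d fun_upd_comp)
  next
    assume "\<exists>c'. d = ntm_conf f g c' \<and> step1 T x c c'"
    then obtain q' dd u e where T: "T q (input_cell x i) (t h) q' dd u e"
      and d: "d = ntm_conf f g (q', min (move_head dd i) (length x + 1), t(h := u), move_head e h)"
      unfolding c by (auto elim!: step1.cases)
    have "(f q, input_cell x i, map scanned [(g \<circ> t, h)], f q', dd, [(g u, e)]) \<in> table (to_ntm f g T q0 qa)"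
      using T by (auto simp: to_ntm_def)
    from ntm_step.intros[OF this] show "ntm_step (to_ntm f g T q0 qa) x (ntm_conf f g c) d"
      by (simp add: c d fun_upd_comp)
  qed
qed

lemma ntm_reachable_to_ntm:
  assumes "inj f" "inj g" "g b = 0"
  shows "ntm_reachable (to_ntm f g T q0 qa) x d \<longleftrightarrow>
    (\<exists>c. d = ntm_conf f g c \<and> (step1 T x)\<^sup>*\<^sup>* (q0, 0, \<lambda>_. b, 0) c)"
proof -
  have init: "ntm_init (to_ntm f g T q0 qa) = ntm_conf f g (q0, 0, \<lambda>_. b, 0)"
    using assms(3) by (simp add: ntm_init_def to_ntm_def comp_def)
  show ?thesis
    unfolding ntm_reachable_def init
  proof
    assume "(ntm_step (to_ntm f g T q0 qa) x)\<^sup>*\<^sup>* (ntm_conf f g (q0, 0, \<lambda>_. b, 0)) d"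
    then show "\<exists>c. d = ntm_conf f g c \<and> (step1 T x)\<^sup>*\<^sup>* (q0, 0, \<lambda>_. b, 0) c"
    proof (induction rule: rtranclp_induct)
      case (step d d')
      then show ?case
        using ntm_step_to_ntm[OF assms(1,2)] by (metis rtranclp.rtrancl_into_rtrancl)
    qed blast
  next
    assume "\<exists>c. d = ntm_conf f g c \<and> (step1 T x)\<^sup>*\<^sup>* (q0, 0, \<lambda>_. b, 0) c"
    then obtain c where "(step1 T x)\<^sup>*\<^sup>* (q0, 0, \<lambda>_. b, 0) c" "d = ntm_conf f g c" by blast
    then show "(ntm_step (to_ntm f g T q0 qa) x)\<^sup>*\<^sup>* (ntm_conf f g (q0, 0, \<lambda>_. b, 0)) d"
    proof (induction arbitrary: d rule: rtranclp_induct)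
      case (step c c')
      then show ?case
        using ntm_step_to_ntm[OF assms(1,2)] by (metis rtranclp.rtrancl_into_rtrancl)
    qed simp
  qed
qed

instance input_cell :: (finite) finite
proof
  have "(UNIV :: 'a input_cell set) = {Left_End, Right_End} \<union> range Sym"
    by (auto intro: input_cell.exhaust)
  then show "finite (UNIV :: 'a input_cell set)" by (metis finite.simps finite_Un finite_imageI finite)
qed

instance move :: finite
proof
  have "(UNIV :: move set) = {Go_Left, Stay, Go_Right}"
    by (auto intro: move.exhaust)
  then show "finite (UNIV :: move set)" by (metis finite.simps)
qed

lemma NSPACE_one_tapeI:
  fixes T :: "('a::finite, 'q::finite, 'g::finite) trans" and b :: 'g
  assumes "\<And>x. x \<in> A \<longleftrightarrow> (\<exists>i t h. (step1 T x)\<^sup>*\<^sup>* (q0, 0, \<lambda>_. b, 0) (qa, i, t, h))"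
    and "\<And>x q i t h. (step1 T x)\<^sup>*\<^sup>* (q0, 0, \<lambda>_. b, 0) (q, i, t, h) \<Longrightarrow> h < s' (length x)"
    and "(\<lambda>n. real (s' n)) \<in> O(s)"
  shows "A \<in> NSPACE s"
proof -
  obtain f :: "'q \<Rightarrow> nat" where f: "inj f" using finite_imp_inj_to_nat_seg[of "UNIV :: 'q set"] by auto
  obtain g0 :: "'g \<Rightarrow> nat" where g0: "inj g0" using finite_imp_inj_to_nat_seg[of "UNIV :: 'g set"] by auto
  \<comment> \<open>The blank of the coded machine is 0, so \<open>b\<close> gets this code and all
    other symbols are shifted away from it.\<close>
  define g where "g = (\<lambda>u. if u = b then 0 else Suc (g0 u))"
  have g: "inj g" "g b = 0" using g0 by (auto simp: g_def inj_def)
  define M where "M = to_ntm f g T q0 qa"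
  note R = ntm_reachable_to_ntm[OF f g, of T q0 qa, folded M_def]
  have "table M \<subseteq> (\<lambda>(q, c, u, q', d, u', e). (f q, c, [g u], f q', d, [(g u', e)])) ` UNIV"
    unfolding M_def to_ntm_def by (auto simp: image_iff)
  then have "finite (table M)" by (rule finite_subset) simp
  then have "wf_ntm M" unfolding wf_ntm_def M_def to_ntm_def by auto
  moreover have "uses_space M s'"
    unfolding uses_space_def R using assms(2) by auto
  moreover have "x \<in> A \<longleftrightarrow> accepts M x" for x
  proof -
    have "accept_state M = f qa" by (simp add: M_def to_ntm_def)
    then show ?thesis unfolding accepts_def R assms(1) using f by (auto simp: inj_eq; metis)
  qed
  ultimately show ?thesis using assms(3) unfolding NSPACE_def by blast
qed

section \<open>Binary numbers\<close>

abbreviation nat_of_bits :: "bool list \<Rightarrow> nat" where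
  "nat_of_bits \<equiv> horner_sum of_bool 2"

lemma nat_of_bits_less: "nat_of_bits bs < 2 ^ length bs"
  by (induction bs) (auto simp: of_bool_def)

text \<open>The appended bit is the most significant one and decides unless both agree. This lets
  the machine compare numbers while reading from the low end, with one flag of memory.\<close>

lemma nat_of_bits_less_append:
  assumes "length bs = length cs"
  shows "nat_of_bits (bs @ [b]) < nat_of_bits (cs @ [c]) \<longleftrightarrow>
    (if b = c then nat_of_bits bs < nat_of_bits cs else c)"
  using assms nat_of_bits_less[of bs] nat_of_bits_less[of cs]
  by (auto simp: horner_sum_append)

lemma binary_nat_of_bits: "bs = [] \<or> last bs \<Longrightarrow> binary (nat_of_bits bs) = bs"
proof (induction bs)
  case Nil
  then show ?case by (simp add: binary.simps)
next
  case (Cons b bs)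
  have "nat_of_bits (b # bs) \<noteq> 0"
    using Cons.prems
  proof (induction bs arbitrary: b)
    case (Cons c bs)
    then show ?case by (metis add_is_0 horner_sum_simps(2) last_ConsR list.distinct(1) mult_is_0 zero_neq_numeral)
  qed simp
  moreover have "bs = [] \<or> last bs" using Cons.prems by (auto split: if_splits)
  ultimately show ?case
    using Cons.IH by (subst binary.simps) (cases b; simp)
qed

section \<open>The machine\<close>

text \<open>
  A column of the work tape holds one bit of each of three numbers: the number of gadgets, the index
  of the gadget at which the robot stands, and an auxiliary number.
\<close>

type_synonym column = "bool \<times> bool \<times> bool"

datatype symbol = Blank | Mark | Col column

text \<open>
  An argument of type \<open>'l option\<close> of \<open>Start\<close>, \<open>St\<close> and \<open>Inc\<close> is the location of the robot within its
  gadget, and \<open>None\<close> in the first pass, which counts the gadgets. The flag of \<open>Fst\<close> and \<open>Snd\<close> says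
  that the goal has been reached. The option of \<open>Snd\<close> is \<open>None\<close> if the first end of the current
  connection was matched with the position of the robot, and otherwise holds the location of that end,
  whose index is then in the auxiliary number.

  In \<open>Rd g md lt ok\<close> and \<open>Pad g md lt a\<close>, a location is compared with the current index if \<open>md\<close> holds,
  and otherwise stored in the auxiliary number; \<open>lt\<close> says that the bits read so far are below those
  of the number of gadgets, and \<open>ok\<close> excludes superfluous zeros. \<open>Rew f b\<close> applies \<open>f\<close> to every column
  on the way back.
\<close>

datatype 'l stage = Start "'l option" | Goal 'l | Fst 'l bool | Snd 'l bool "'l option"

datatype 'l boundary = St "'l option" | Lc "'l stage"

datatype ('l, 's) control =
    Begin
  | At "'l boundary"
  | Inc "'l option" 's
  | Rd "'l stage" bool bool bool
  | Pad "'l stage" bool bool 'l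
  | Rew "column \<Rightarrow> column" "'l boundary"
  | Home 'l
  | Acc

fun put :: "bool \<Rightarrow> bool \<Rightarrow> column \<Rightarrow> column" where
  "put md b (m, k, d) = (m, k, if md then d else b)"

text \<open>Besides making the stored index the current one, this leaves its bitwise complement on
  the auxiliary track, from where the next scan of the State letters counts upwards.\<close>

fun commit :: "column \<Rightarrow> column" where
  "commit (m, k, d) = (m, d, \<not> d)"

fun restore :: "column \<Rightarrow> column" where
  "restore (m, k, d) = (m, k, \<not> k)"

text \<open>With \<open>True\<close> the index has matched the current one, and a repeated argument
  demands that the locations agree as well; with \<open>False\<close> any location passes.
  \<open>restore\<close> is used where a stored index may be discarded, \<open>id\<close> where it
  must survive until the second end has been read.\<close>

inductive finish :: "'l stage \<Rightarrow> bool \<Rightarrow> 'l \<Rightarrow> (column \<Rightarrow> column) \<Rightarrow> 'l stage \<Rightarrow> bool" where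
  "finish (Start None) False a commit (Goal a)"
| "finish (Start (Some r)) False a restore (Goal r)"
| "finish (Goal r) False a restore (Fst r False)"
| "finish (Goal r) True r restore (Fst r True)"
| "finish (Fst r f) True r id (Snd r f None)"
| "finish (Fst r f) False a id (Snd r f (Some a))"
| "finish (Snd r f None) False a commit (Fst a f)"
| "finish (Snd r f (Some a)) True r commit (Fst a f)"
| "finish (Snd r f (Some a')) False a restore (Fst r f)"

text \<open>In the first pass an increment writes the limit track in parallel with the auxiliary
  one, and an overflow appends a column (\<open>inc_extend\<close>). Later an overflow marks the
  gadget of the robot, and \<open>inc_wrap\<close> may cross a tunnel there. A bit read beyond the
  last column meets no rule and \<open>pad_end\<close> demands \<open>lt\<close>, so overlong and
  out-of-range indices block the run.\<close>

inductive delta :: "('l, 's) gadget \<Rightarrow> (('l, 's) letter, ('l, 's) control, symbol) trans"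
  for G :: "('l, 's) gadget" where
  mark: "delta G Begin c Blank (At (St None)) Go_Right Mark Stay"
| state: "delta G (At (St r)) (Sym (State s)) Mark (Inc r s) Go_Right Mark Go_Right"
| no_state: "(\<And>s. c \<noteq> Sym (State s)) \<Longrightarrow>
    delta G (At (St r)) c Mark (At (Lc (Start r))) Stay Mark Stay"
| inc_carry: "delta G (Inc r s) c (Col (m, k, True)) (Inc r s) Stay (Col (r \<noteq> None \<and> m, k, False)) Go_Right"
| inc_stop: "delta G (Inc r s) c (Col (m, k, False)) (Rew id (St r)) Stay (Col (r = None \<or> m, k, True)) Go_Left"
| inc_extend: "delta G (Inc None s) c Blank (Rew id (St None)) Stay (Col (True, False, True)) Go_Left"
| inc_wrap: "b = a \<or> (\<exists>s'. (a, b, s') \<in> G s) \<Longrightarrow>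
    delta G (Inc (Some a) s) c Blank (Rew id (St (Some b))) Stay Blank Go_Left"
| read: "delta G (At (Lc g)) c Mark (Rd g md False True) Stay Mark Go_Right"
| last: "delta G (At (Lc (Fst a f))) Right_End Mark (if f then Acc else Home a) Stay Mark Stay"
| read_bit: "(md \<Longrightarrow> b = k) \<Longrightarrow>
    delta G (Rd g md lt ok) (Sym (Bit b)) (Col (m, k, d)) (Rd g md (if b = m then lt else m) b)
      Go_Right (Col (put md b (m, k, d))) Go_Right"
| read_loc: "delta G (Rd g md lt True) (Sym (Loc a)) u (Pad g md lt a) Go_Right u Stay"
| pad: "(md \<Longrightarrow> \<not> k) \<Longrightarrow>
    delta G (Pad g md lt a) c (Col (m, k, d)) (Pad g md (lt \<or> m) a) Stay (Col (put md False (m, k, d))) Go_Right"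
| pad_end: "finish g md a f g' \<Longrightarrow>
    delta G (Pad g md True a) c Blank (Rew f (Lc g')) Stay Blank Go_Left"
| rewind: "delta G (Rew f b) c (Col v) (Rew f b) Stay (Col (f v)) Go_Left"
| rewind_end: "delta G (Rew f b) c Mark (At b) Stay Mark Stay"
| home: "c \<noteq> Left_End \<Longrightarrow> delta G (Home a) c u (Home a) Go_Left u Stay"
| home_end: "delta G (Home a) Left_End u (At (St (Some a))) Go_Right u Stay"

instance symbol :: finite
proof
  have "(UNIV :: symbol set) = {Blank, Mark} \<union> range Col"
    by (auto intro: symbol.exhaust)
  then show "finite (UNIV :: symbol set)" by (metis finite.simps finite_Un finite_imageI finite)
qed

instance stage :: (finite) finite
proof
  have "(UNIV :: 'a stage set) = range Start \<union> range Goal \<union> range (\<lambda>(a, f). Fst a f) \<union>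
      range (\<lambda>(a, f, r). Snd a f r)" (is "_ = ?A")
  proof (intro set_eqI iffI)
    fix g :: "'a stage"
    show "g \<in> ?A" by (cases g) (auto simp: image_iff)
  qed simp
  then show "finite (UNIV :: 'a stage set)" by (metis finite_Un finite_imageI finite)
qed

instance boundary :: (finite) finite
proof
  have "(UNIV :: 'a boundary set) = range St \<union> range Lc"
    by (auto intro: boundary.exhaust)
  then show "finite (UNIV :: 'a boundary set)" by (metis finite_Un finite_imageI finite)
qed

instance control :: (finite, finite) finite
proof
  have "(UNIV :: ('a, 'b) control set) = {Begin, Acc} \<union> range At \<union> range (\<lambda>(r, s). Inc r s) \<union>
      range (\<lambda>(g, md, lt, ok). Rd g md lt ok) \<union> range (\<lambda>(g, md, lt, a). Pad g md lt a) \<union>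
      range (\<lambda>(f, b). Rew f b) \<union> range Home" (is "_ = ?A")
  proof (intro set_eqI iffI)
    fix q :: "('a, 'b) control"
    show "q \<in> ?A" by (cases q) (auto simp: image_iff)
  qed simp
  then show "finite (UNIV :: ('a, 'b) control set)"
    by (rule ssubst) (intro finite_UnI finite_imageI; simp)
qed

definition tape :: "column list \<Rightarrow> nat \<Rightarrow> symbol" where
  "tape w j = (if j = 0 then Mark else if j \<le> length w then Col (w ! (j - 1)) else Blank)"

lemma tape_simps [simp]:
  "tape w 0 = Mark"
  "tape (us @ v # vs) (Suc (length us)) = Col v"
  "tape w (Suc (length w)) = Blank"
  "(tape (us @ v # vs))(Suc (length us) := Col v') = tape (us @ v' # vs)"
  "(tape w)(Suc (length w) := Col v) = tape (w @ [v])"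
  by (auto simp: tape_def fun_eq_iff nth_append nth_Cons')

lemma tape_Mark: "(\<lambda>_. Blank)(0 := Mark) = tape []"
  by (auto simp: tape_def fun_eq_iff)

definition lim :: "column list \<Rightarrow> nat" where
  "lim w = nat_of_bits (map fst w)"

definition cur :: "column list \<Rightarrow> nat" where
  "cur w = nat_of_bits (map (fst \<circ> snd) w)"

definition aux :: "column list \<Rightarrow> nat" where
  "aux w = nat_of_bits (map (snd \<circ> snd) w)"

lemma column_list_simps [simp]:
  "lim [] = 0" "cur [] = 0" "aux [] = 0"
  "lim ((m, k, d) # w) = of_bool m + 2 * lim w"
  "cur ((m, k, d) # w) = of_bool k + 2 * cur w"
  "aux ((m, k, d) # w) = of_bool d + 2 * aux w"
  "lim (us @ vs) = lim us + 2 ^ length us * lim vs"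
  "cur (us @ vs) = cur us + 2 ^ length us * cur vs"
  "aux (us @ vs) = aux us + 2 ^ length us * aux vs"
  by (simp_all add: lim_def cur_def aux_def horner_sum_append)

lemma column_list_less: "lim w < 2 ^ length w" "cur w < 2 ^ length w" "aux w < 2 ^ length w"
  using nat_of_bits_less[of "map _ w"] by (simp_all add: lim_def cur_def aux_def)

lemma map_commit [simp]: "lim (map commit w) = lim w" "cur (map commit w) = aux w"
    "Suc (aux (map commit w) + aux w) = 2 ^ length w"
  by (induction w) (auto simp: lim_def cur_def aux_def of_bool_def)

lemma map_restore [simp]: "lim (map restore w) = lim w" "cur (map restore w) = cur w"
    "Suc (aux (map restore w) + cur w) = 2 ^ length w"
  by (induction w) (auto simp: lim_def cur_def aux_def of_bool_def)

section \<open>Parsing the input\<close>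

definition gadgets :: "('l, 's) letter list \<Rightarrow> nat" where
  "gadgets x = length (takeWhile (\<lambda>c. c \<in> range State) x)"

definition locs :: "('l, 's) letter list \<Rightarrow> ('l, 's) letter list" where
  "locs x = drop (gadgets x) x"

definition encode_locs :: "(nat \<times> 'l) list \<Rightarrow> ('l, 's) letter list" where
  "encode_locs ps = concat (map encode_loc ps)"

definition loc_list :: "('l, 's) system \<Rightarrow> (nat \<times> 'l) list" where
  "loc_list S = start_loc S # goal_loc S # concat (map (\<lambda>(p, q). [p, q]) (connections S))"

lemma encode_locs_simps [simp]:
  "encode_locs [] = []"
  "encode_locs (p # ps) = encode_loc p @ encode_locs ps"
  "encode_locs (ps @ qs) = encode_locs ps @ encode_locs qs"
  by (simp_all add: encode_locs_def)

lemma encode_loc_nonempty [simp]: "encode_loc p \<noteq> []"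
  by (cases p) simp

lemma encode_eq: "encode S = map State (initial_states S) @ encode_locs (loc_list S)"
proof -
  have "concat (map (\<lambda>(p, q). encode_loc p @ encode_loc q) es) =
      (encode_locs (concat (map (\<lambda>(p, q). [p, q]) es)) :: ('l, 's) letter list)" for es :: "((nat \<times> 'l) \<times> nat \<times> 'l) list"
    by (induction es) auto
  then show ?thesis by (simp add: encode_def loc_list_def)
qed

lemma gadgets_encode [simp]:
  fixes S :: "('l, 's) system"
  shows "gadgets (encode S) = length (initial_states S)"
proof -
  obtain y ys where y: "(encode_locs (loc_list S) :: ('l, 's) letter list) = y # ys" "y \<notin> range State"
    using encode_loc_not_State[of "start_loc S" "encode_locs (tl (loc_list S))"] by (auto simp: loc_list_def)
  have "takeWhile (\<lambda>c. c \<in> range State) (map State ss @ y # ys) = map State ss" for ss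
    using y(2) by (induction ss) auto
  then show ?thesis by (simp add: gadgets_def encode_eq y(1))
qed

lemma locs_encode [simp]: "locs (encode S) = encode_locs (loc_list S)"
  unfolding locs_def gadgets_encode by (simp add: encode_eq)

lemma encode_locs_prefix:
  assumes "encode_locs ps @ u = encode_locs qs"
  shows "\<exists>qs'. qs = ps @ qs'"
  using assms
proof (induction ps arbitrary: qs)
  case (Cons p ps)
  then show ?case by (cases qs) (auto simp: encode_loc_append_inject)
qed simp

lemma locs_encode_prefix:
  assumes "encode_locs ps @ u = locs (encode S)"
  shows "\<exists>qs. loc_list S = ps @ qs"
  using encode_locs_prefix assms by fastforce

text \<open>The parity excludes that \<open>p\<close> ends one connection and \<open>q\<close>
  begins the next.\<close>

lemma pairs_consecutive:
  assumes "concat (map (\<lambda>(p, q). [p, q]) es) = ps @ p # q # qs" "even (length ps)"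
  shows "(p, q) \<in> set es"
  using assms
proof (induction es arbitrary: ps)
  case (Cons e es)
  show ?case
  proof (cases ps)
    case Nil
    then show ?thesis using Cons.prems by (auto split: prod.splits)
  next
    case (Cons p' ps')
    then obtain q' ps'' where ps: "ps = p' # q' # ps''" using Cons.prems(2) by (cases ps') auto
    then show ?thesis using Cons.prems Cons.IH[of ps''] by (auto split: prod.splits)
  qed
qed simp

lemma gadgets_le: "gadgets x \<le> length x"
  unfolding gadgets_def by (rule length_takeWhile_le)

lemma gadgets_nth: "j < gadgets x \<Longrightarrow> x ! j \<in> range State"
  unfolding gadgets_def by (metis nth_mem set_takeWhileD takeWhile_nth)

lemma gadgets_nth_not: "gadgets x < length x \<Longrightarrow> x ! gadgets x \<notin> range State"
  unfolding gadgets_def by (rule nth_length_takeWhile)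

lemma input_cell_SymD:
  "input_cell x i = Sym c \<Longrightarrow> 0 < i \<and> i \<le> length x \<and> x ! (i - 1) = c \<and> drop (i - 1) x = c # drop i x"
  by (cases i) (auto simp: input_cell_def Cons_nth_drop_Suc split: if_splits)

lemma input_cell_Right_EndD: "input_cell x i = Right_End \<Longrightarrow> 0 < i \<and> drop (i - 1) x = []"
  by (auto simp: input_cell_def split: if_splits)

lemma input_cell_drop: "drop i x = c # y \<Longrightarrow> input_cell x (Suc i) = Sym c \<and> i < length x \<and> drop (Suc i) x = y"
proof -
  assume d: "drop i x = c # y"
  then have i: "i < length x" by (metis drop_all leI list.distinct(1))
  then show ?thesis
    using Cons_nth_drop_Suc[OF i] d by (auto simp: input_cell_def)
qed

text \<open>The machine sees locations, never a system. An even number of them after start and goal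
  suffices to group them into connections, so an accepted word is an encoding.\<close>

lemma encode_decompose:
  assumes "locs x = encode_locs (p # q # ps)" "even (length ps)"
  obtains S where "x = encode S" "loc_list S = p # q # ps" "length (initial_states S) = gadgets x"
proof -
  have "\<exists>es. concat (map (\<lambda>(p, q). [p, q]) es) = ps"
    using assms(2)
  proof (induction ps rule: induct_list012)
    case (3 p q ps)
    then obtain es where "concat (map (\<lambda>(p, q). [p, q]) es) = ps" by auto
    then show ?case by (intro exI[of _ "(p, q) # es"]) auto
  qed (auto intro: exI[of _ "[]"])
  then obtain es where es: "concat (map (\<lambda>(p, q). [p, q]) es) = ps" ..
  have "set (take (gadgets x) x) \<subseteq> range State"
    by (auto simp: gadgets_def simp flip: takeWhile_eq_take dest: set_takeWhileD)
  then obtain ss where ss: "take (gadgets x) x = map State ss"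
    by (metis ex_map_conv subset_code(1) imageE)
  let ?S = "\<lparr>initial_states = ss, connections = es, start_loc = p, goal_loc = q\<rparr>"
  have "x = encode ?S"
    using append_take_drop_id[of "gadgets x" x] assms(1) es
    unfolding encode_eq loc_list_def by (simp add: locs_def ss)
  moreover have "loc_list ?S = p # q # ps" by (simp add: loc_list_def es)
  moreover have "length ss = gadgets x"
    using arg_cong[OF ss, of length] gadgets_le[of x] by simp
  ultimately show ?thesis using that by simp
qed

lemma wf_system_loc_list:
  "wf_system S \<longleftrightarrow> (\<forall>p \<in> set (loc_list S). fst p < length (initial_states S))"
proof -
  have "set es \<subseteq> system_locs S \<times> system_locs S \<longleftrightarrow>
      list_all (\<lambda>p. p \<in> system_locs S) (concat (map (\<lambda>(p, q). [p, q]) es))" for es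
  proof (induction es)
    case (Cons e es)
    then show ?case by (cases e) simp
  qed simp
  moreover have "p \<in> system_locs S \<longleftrightarrow> fst p < length (initial_states S)" for p
    by (cases p) (simp add: system_locs_def)
  ultimately show ?thesis by (simp add: wf_system_def loc_list_def list_all_iff conj_ac)
qed

section \<open>Soundness\<close>

context
  fixes G :: "('l, 's) gadget" and x :: "('l, 's) letter list"
begin

text \<open>
  As the input need not be an encoding, claims about the encoded system are conditional; they hold
  for the system, if any, that the input encodes.
\<close>

definition reach :: "nat \<times> 'l \<Rightarrow> bool" where
  "reach p \<longleftrightarrow> (\<forall>S. x = encode S \<longrightarrow> wf_system S \<longrightarrow> static_reach G S p)"

definition goal_reached :: bool where
  "goal_reached \<longleftrightarrow> (\<forall>S. x = encode S \<longrightarrow> wf_system S \<longrightarrow> static_reach G S (goal_loc S))"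

text \<open>\<open>2 ^ length w \<le> 2 * j + 1\<close> forbids columns beyond the binary length of
  \<open>j\<close>, while \<open>aux w = j\<close> forces at least that many. Equality of the limit
  and auxiliary tracks makes the limit correct whenever the count stops.\<close>

definition counted :: "column list \<Rightarrow> nat \<Rightarrow> bool" where
  "counted w j \<longleftrightarrow> map fst w = map (snd \<circ> snd) w \<and> aux w = j \<and> 2 ^ length w \<le> 2 * j + 1"

definition ready :: "column list \<Rightarrow> bool" where
  "ready w \<longleftrightarrow> lim w = gadgets x \<and> 2 ^ length w \<le> 2 * gadgets x + 1"

text \<open>
  The auxiliary number counts upwards from the complement of the current index \<open>c\<close> to \<open>2 ^ length w\<close>,
  so that it overflows at the State letter with index \<open>c\<close>.
\<close>

definition lookup :: "nat \<Rightarrow> nat \<Rightarrow> nat \<Rightarrow> nat \<Rightarrow> bool" where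
  "lookup n d c j \<longleftrightarrow> d + c + 1 = j \<or> d + c + 1 = j + 2 ^ n"

text \<open>In stage \<open>Snd\<close> the stored index of the first end is asserted only if
  \<open>md\<close> holds, since storing the second end overwrites it. The parity of
  \<open>length ps\<close> tells which end of a connection comes next, start and goal counting
  two.\<close>

fun stage_inv :: "bool \<Rightarrow> 'l stage \<Rightarrow> (nat \<times> 'l) list \<Rightarrow> column list \<Rightarrow> bool" where
  "stage_inv md (Start None) ps w = (ps = [])"
| "stage_inv md (Start (Some a)) ps w = (ps = [] \<and> reach (cur w, a))"
| "stage_inv md (Goal a) ps w = (length ps = 1 \<and> reach (cur w, a))"
| "stage_inv md (Fst a f) ps w =
    (even (length ps) \<and> 2 \<le> length ps \<and> reach (cur w, a) \<and> (f \<longrightarrow> goal_reached))"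
| "stage_inv md (Snd a f r) ps w =
    (odd (length ps) \<and> 3 \<le> length ps \<and> reach (cur w, a) \<and> (f \<longrightarrow> goal_reached) \<and>
     (case r of None \<Rightarrow> last ps = (cur w, a) | Some b \<Rightarrow> md \<longrightarrow> last ps = (aux w, b)))"

text \<open>\<open>i\<close> is the input cell of the next letter; as cell 0 is the left end marker,
  \<open>i - 1\<close> letters have been consumed. \<open>u\<close> is the part of an unfinished
  location already read.\<close>

definition parsed :: "(nat \<times> 'l) list \<Rightarrow> ('l, 's) letter list \<Rightarrow> nat \<Rightarrow> bool" where
  "parsed ps u i \<longleftrightarrow> 0 < i \<and> locs x = encode_locs ps @ u @ drop (i - 1) x \<and> (\<forall>p \<in> set ps. fst p < gadgets x)"

fun boundary_inv :: "'l boundary \<Rightarrow> nat \<Rightarrow> column list \<Rightarrow> bool" where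
  "boundary_inv (St None) i w = (\<exists>j \<le> gadgets x. i = Suc j \<and> counted w j)"
| "boundary_inv (St (Some a)) i w = (\<exists>j \<le> gadgets x. i = Suc j \<and> ready w \<and> reach (cur w, a) \<and>
     lookup (length w) (aux w) (cur w) j)"
| "boundary_inv (Lc g) i w = (\<exists>ps. parsed ps [] i \<and> ready w \<and> stage_inv True g ps w \<and>
     (\<forall>a f. g = Fst a f \<longrightarrow> aux w + cur w + 1 = 2 ^ length w))"

abbreviation (input) track :: "bool \<Rightarrow> column \<Rightarrow> bool" where
  "track md \<equiv> (if md then fst \<circ> snd else snd \<circ> snd)"

text \<open>In \<open>Inc\<close>, \<open>c\<close> is the counter before the increment: the carry
  has cleared the ones in \<open>us\<close>, so adding one to \<open>vs\<close> remains to be done.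
  The letter \<open>j\<close> has already been passed, whence \<open>i = Suc (Suc j)\<close>. In
  \<open>Rew\<close>, the boundary invariant is claimed of the tape as it will be once
  \<open>f\<close> has been applied to the columns still ahead.\<close>

fun inv :: "('l, 's) control \<Rightarrow> nat \<Rightarrow> (nat \<Rightarrow> symbol) \<Rightarrow> nat \<Rightarrow> bool" where
  "inv Begin i t h = (i = 0 \<and> t = (\<lambda>_. Blank) \<and> h = 0)"
| "inv (At b) i t h = (\<exists>w. t = tape w \<and> h = 0 \<and> boundary_inv b i w)"
| "inv (Inc r s) i t h = (\<exists>us vs j c. t = tape (us @ vs) \<and> h = Suc (length us) \<and> j < gadgets x \<and>
     i = Suc (Suc j) \<and> x ! j = State s \<and> aux us = 0 \<and> 2 ^ length us * (aux vs + 1) = c + 1 \<and>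
     (case r of None \<Rightarrow> c = j \<and> map fst (us @ vs) = map (snd \<circ> snd) (us @ vs) \<and> 2 ^ length (us @ vs) \<le> 2 * j + 1
      | Some a \<Rightarrow> ready (us @ vs) \<and> reach (cur (us @ vs), a) \<and>
          lookup (length (us @ vs)) c (cur (us @ vs)) j))"
| "inv (Rd g md lt ok) i t h = (\<exists>us vs ps bs. t = tape (us @ vs) \<and> h = Suc (length us) \<and>
     parsed ps (map Bit bs) i \<and> ready (us @ vs) \<and> stage_inv md g ps (us @ vs) \<and>
     map (track md) us = bs \<and> lt = (nat_of_bits bs < lim us) \<and> ok = (bs = [] \<or> last bs))"
| "inv (Pad g md lt a) i t h = (\<exists>us vs ps k. t = tape (us @ vs) \<and> h = Suc (length us) \<and>
     parsed ps (encode_loc (k, a)) i \<and> ready (us @ vs) \<and> stage_inv md g ps (us @ vs) \<and>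
     nat_of_bits (map (track md) us) = k \<and> lt = (k < lim us))"
| "inv (Rew f b) i t h = (\<exists>us vs. t = tape (us @ vs) \<and> h = length us \<and> boundary_inv b i (map f us @ vs))"
| "inv (Home a) i t h = (\<exists>w. t = tape w \<and> h = 0 \<and> ready w \<and> reach (cur w, a) \<and>
     aux w + cur w + 1 = 2 ^ length w)"
| "inv Acc i t h = (h = 0 \<and> (\<exists>S. x = encode S \<and> wf_system S \<and> static_reach G S (goal_loc S)))"

lemma stage_inv_store:
  "cur w' = cur w \<Longrightarrow> stage_inv md g ps w \<Longrightarrow> stage_inv False g ps w'"
  by (induction md g ps w rule: stage_inv.induct) (auto split: option.splits)

lemma stage_inv_mode: "stage_inv True g ps w \<Longrightarrow> stage_inv md g ps w"
  by (cases md) (auto intro: stage_inv_store)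

section \<open>Reachability claims from parsed locations\<close>

lemma parsed_input:
  assumes "parsed ps u i" "input_cell x i = Sym c"
  shows "parsed ps (u @ [c]) (Suc i)" "i \<le> length x"
  using assms input_cell_SymD[OF assms(2)] by (auto simp: parsed_def)

lemma parsed_encode:
  assumes "parsed ps (encode_loc p) i" "fst p < gadgets x"
  shows "parsed (ps @ [p]) [] i"
  using assms by (auto simp: parsed_def)

lemma parsed_loc_list:
  assumes "parsed ps u i" "x = encode S"
  shows "\<exists>qs. loc_list S = ps @ qs"
proof -
  have "encode_locs ps @ u @ drop (i - 1) x = locs (encode S)"
    using assms unfolding parsed_def by metis
  then show ?thesis by (rule locs_encode_prefix)
qed

lemma reach_start:
  assumes "parsed [p] u i"
  shows "reach p"
  using parsed_loc_list[OF assms] by (auto simp: reach_def loc_list_def static_reach_def)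

lemma reach_goal:
  assumes "parsed [p, q] u i" "reach q"
  shows goal_reached
  using parsed_loc_list[OF assms(1)] assms(2) by (auto simp: reach_def loc_list_def goal_reached_def)

text \<open>Both directions are covered, as the robot may stand at either end. Once start and goal
  are split off, an even number of locations precedes \<open>p\<close>, so \<open>p\<close> and
  \<open>q\<close> form one connection.\<close>

lemma reach_connection:
  assumes "parsed (ps @ [q]) u i" "odd (length ps)" "3 \<le> length ps" "last ps = p"
    and "reach p \<or> reach q"
  shows "reach p \<and> reach q"
proof -
  have "static_reach G S p \<and> static_reach G S q" if S: "x = encode S" "wf_system S" for S
  proof -
    obtain qs where qs: "loc_list S = ps @ q # qs" using parsed_loc_list[OF assms(1) S(1)] by auto
    obtain s g ps' where ps: "ps = s # g # ps' @ [p]" "even (length ps')"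
    proof -
      obtain s g ps1 where 1: "ps = s # g # ps1" "ps1 \<noteq> []"
        using assms(3) by (cases ps; cases "tl ps"; cases "tl (tl ps)") auto
      show ?thesis
        using that[of s g "butlast ps1"] 1 assms(2,4)
        by (metis append_butlast_last_id even_Suc last_ConsR length_Cons length_append_singleton list.distinct(1))
    qed
    have "(p, q) \<in> set (connections S)"
      using pairs_consecutive[of "connections S" ps' p q qs] qs ps by (auto simp: loc_list_def)
    then have "(p, q) \<in> static_edges G S" "(q, p) \<in> static_edges G S"
      unfolding static_edges_def by auto
    moreover have "static_reach G S p \<or> static_reach G S q"
      using assms(5) S unfolding reach_def by blast
    ultimately show ?thesis
      unfolding static_reach_def by (meson rtrancl.rtrancl_into_rtrancl)
  qed
  then show ?thesis unfolding reach_def by blast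
qed

lemma reach_tunnel:
  assumes "reach (j, a)" "j < gadgets x" "x ! j = State s" "(a, b, s') \<in> G s"
  shows "reach (j, b)"
  unfolding reach_def
proof (intro allI impI)
  fix S assume S: "x = encode S" "wf_system S"
  have j: "j < length (initial_states S)" using assms(2) S(1) by simp
  then have "x ! j = State (initial_states S ! j)" unfolding S(1) encode_eq by (simp add: nth_append)
  then have "((j, a), (j, b)) \<in> static_edges G S"
    using j assms(3,4) unfolding static_edges_def by auto
  moreover have "static_reach G S (j, a)"
    using assms(1) S unfolding reach_def by blast
  ultimately show "static_reach G S (j, b)"
    unfolding static_reach_def by (meson rtrancl.rtrancl_into_rtrancl)
qed

lemma finish_inv:
  assumes "finish g md a f g'" "stage_inv md g ps w" "parsed (ps @ [(k, a)]) [] i" "ready w"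
    and "k = (if md then cur w else aux w)"
  shows "boundary_inv (Lc g') i (map f w)"
proof -
  have r: "ready (map f' w) \<longleftrightarrow> ready w" if "f' = commit \<or> f' = restore \<or> f' = id" for f'
    using that by (auto simp: ready_def)
  note [simp] = r
  from assms(1) have "parsed (ps @ [(k, a)]) [] i \<and> ready (map f w) \<and>
     stage_inv True g' (ps @ [(k, a)]) (map f w) \<and>
     (\<forall>a f'. g' = Fst a f' \<longrightarrow> aux (map f w) + cur (map f w) + 1 = 2 ^ length (map f w))"
    using assms(2-)
  proof cases
    case 1
    then show ?thesis using assms reach_start by auto
  next
    case (2 r)
    then show ?thesis using assms by auto
  next
    case (3 r)
    then show ?thesis using assms by auto
  next
    case 4
    then show ?thesis using assms reach_goal by (auto simp: length_Suc_conv)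
  next
    case (5 f)
    then show ?thesis using assms by auto
  next
    case (6 r f)
    then show ?thesis using assms by auto
  next
    case (7 r f)
    then show ?thesis using assms reach_connection[OF assms(3)] by auto
  next
    \<comment> \<open>The second end was only compared, so the auxiliary number is still the index
      of the first end, which \<open>commit\<close> makes current.\<close>
    case (8 f b)
    then show ?thesis using assms reach_connection[OF assms(3)] by auto
  next
    case (9 r f b)
    then show ?thesis using assms by auto
  qed
  then show ?thesis by auto
qed

section \<open>Preservation of the invariant\<close>

lemma map_put_track:
  assumes "md \<Longrightarrow> b = k"
  shows "track md (put md b (m, k, d)) = b" "cur (us @ put md b (m, k, d) # vs) = cur (us @ (m, k, d) # vs)"
    "ready (us @ put md b (m, k, d) # vs) = ready (us @ (m, k, d) # vs)"
    "lim (us @ [put md b (m, k, d)]) = lim (us @ [(m, k, d)])"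
    "stage_inv md g ps (us @ (m, k, d) # vs) \<Longrightarrow> stage_inv md g ps (us @ put md b (m, k, d) # vs)"
  using assms by (cases md; auto simp: ready_def intro: stage_inv_store[rotated])+

lemma inv_step:
  assumes "step1 (delta G) x (q, i, t, h) (q', i', t', h')" "inv q i t h" "i \<le> length x + 1"
  shows "inv q' i' t' h'"
proof -
  from assms(1) obtain d u e where D: "delta G q (input_cell x i) (t h) q' d u e"
    and eqs: "i' = min (move_head d i) (length x + 1)" "t' = t(h := u)" "h' = move_head e h"
    by (cases rule: step1.cases) auto
  note I = assms(2)
  from D show ?thesis
  proof cases
    case mark
    then show ?thesis
      using I by (auto simp: eqs tape_Mark counted_def intro!: exI[of _ "[]"])
  next
    case (state r s)
    obtain w where w: "t = tape w" "h = 0" "boundary_inv (St r) i w" using I state by auto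
    obtain j where j: "i = Suc j" "j \<le> gadgets x" using w(3) by (cases r) auto
    have x: "x ! j = State s" "j < length x" using input_cell_SymD[of x i] \<open>input_cell x i = _\<close> j by auto
    then have jg: "j < gadgets x" using j(2) gadgets_nth_not[of x] by (metis le_neq_implies_less rangeI)
    have "i' = Suc (Suc j)" using x j state by (simp add: eqs)
    moreover have "t' = tape ([] @ w)" "h' = Suc (length [])" using w state by (auto simp: eqs fun_eq_iff)
    ultimately show ?thesis
      unfolding \<open>q' = Inc r s\<close> inv.simps using w(3) x(1) jg j(1)
      by (intro exI[of _ "[]"] exI[of _ w] exI[of _ j] exI[of _ "aux w"])
        (cases r; auto simp: counted_def)
  next
    case (no_state r)
    then obtain w where w: "t = tape w" "h = 0" "boundary_inv (St r) i w" using I by auto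
    obtain j where j: "i = Suc j" "j \<le> gadgets x" using w(3) by (cases r) auto
    have "j = gadgets x"
    proof (rule ccontr)
      assume "j \<noteq> gadgets x"
      then have "j < gadgets x" using j by simp
      then obtain s where "x ! j = State s" using gadgets_nth[of j x] by auto
      then have "input_cell x i = Sym (State s)"
        using \<open>j < gadgets x\<close> gadgets_le[of x] by (simp add: j input_cell_def)
      then show False using no_state by auto
    qed
    then have "parsed [] [] i" by (simp add: parsed_def j locs_def)
    moreover have "ready w"
    proof (cases r)
      case None
      then have "counted w (gadgets x)" using w(3) \<open>j = gadgets x\<close> \<open>i = Suc j\<close> by simp
      then show ?thesis unfolding ready_def counted_def lim_def aux_def by metis
    qed (use w(3) in auto)
    moreover have "stage_inv True (Start r) [] w" using w(3) by (cases r) auto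
    ultimately show ?thesis using no_state w assms(3) by (auto simp: eqs fun_upd_idem)
  next
    case (inc_carry r s m k)
    then obtain us vs j c where *: "t = tape (us @ vs)" "h = Suc (length us)" "j < gadgets x"
       "i = Suc (Suc j)" "x ! j = State s" "aux us = 0" "2 ^ length us * (aux vs + 1) = c + 1"
       "case r of None \<Rightarrow> c = j \<and> map fst (us @ vs) = map (snd \<circ> snd) (us @ vs) \<and> 2 ^ length (us @ vs) \<le> 2 * j + 1
      | Some a \<Rightarrow> ready (us @ vs) \<and> reach (cur (us @ vs), a) \<and>
          lookup (length (us @ vs)) c (cur (us @ vs)) j"
      using I by auto
    obtain vs' where vs: "vs = (m, k, True) # vs'"
      using inc_carry * by (cases vs) auto
    let ?us = "us @ [(r \<noteq> None \<and> m, k, False)]"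
    have "aux ?us = 0" "2 ^ length ?us * (aux vs' + 1) = c + 1"
      using *(6,7) by (auto simp: vs algebra_simps)
    moreover have "t' = tape (?us @ vs')" "h' = Suc (length ?us)" "i' = i"
      using inc_carry * assms(3) by (auto simp: eqs vs)
    moreover have "case r of None \<Rightarrow> c = j \<and> map fst (?us @ vs') = map (snd \<circ> snd) (?us @ vs') \<and> 2 ^ length (?us @ vs') \<le> 2 * j + 1
      | Some a \<Rightarrow> ready (?us @ vs') \<and> reach (cur (?us @ vs'), a) \<and>
          lookup (length (?us @ vs')) c (cur (?us @ vs')) j"
      using *(8) by (cases r) (auto simp: vs ready_def)
    ultimately show ?thesis
      unfolding \<open>q' = _\<close> inv.simps using *(3,4,5) by blast
  next
    case (inc_stop r s m k)
    then obtain us vs j c where *: "t = tape (us @ vs)" "h = Suc (length us)" "j < gadgets x"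
       "i = Suc (Suc j)" "x ! j = State s" "aux us = 0" "2 ^ length us * (aux vs + 1) = c + 1"
       "case r of None \<Rightarrow> c = j \<and> map fst (us @ vs) = map (snd \<circ> snd) (us @ vs) \<and> 2 ^ length (us @ vs) \<le> 2 * j + 1
      | Some a \<Rightarrow> ready (us @ vs) \<and> reach (cur (us @ vs), a) \<and>
          lookup (length (us @ vs)) c (cur (us @ vs)) j"
      using I by auto
    obtain vs' where vs: "vs = (m, k, False) # vs'"
      using inc_stop * by (cases vs) auto
    let ?w = "us @ (r = None \<or> m, k, True) # vs'"
    have "aux ?w = c + 1" using *(6,7) by (auto simp: vs algebra_simps)
    then have "boundary_inv (St r) i ?w"
      using *(3,4,8) by (cases r) (auto simp: vs ready_def counted_def lookup_def)
    moreover have "t' = tape ?w" "h' = length us" "i' = i"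
      using inc_stop * assms(3) by (auto simp: eqs vs)
    ultimately show ?thesis
      unfolding \<open>q' = _\<close> inv.simps by (intro exI[of _ us] exI) auto
  next
    case (inc_extend s)
    then obtain us vs j where *: "t = tape (us @ vs)" "h = Suc (length us)" "j < gadgets x"
       "i = Suc (Suc j)" "x ! j = State s" "aux us = 0" "2 ^ length us * (aux vs + 1) = j + 1"
       "map fst (us @ vs) = map (snd \<circ> snd) (us @ vs)" "2 ^ length (us @ vs) \<le> 2 * j + 1"
      using I by auto
    have vs: "vs = []"
      using inc_extend * by (cases vs) auto
    let ?w = "us @ [(True, False, True)]"
    \<comment> \<open>With \<open>n = length us\<close>, the overflow means
      \<open>j + 1 = 2 ^ n\<close>, so the new width satisfies
      \<open>2 ^ (n + 1) = 2 * (j + 1)\<close>, within the bound of \<open>counted\<close>.\<close>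
    have "boundary_inv (St None) i ?w"
      using * by (auto simp: vs counted_def)
    moreover have "t' = tape ?w" "h' = length us" "i' = i"
      using inc_extend * assms(3) by (auto simp: eqs vs)
    ultimately show ?thesis
      unfolding \<open>q' = _\<close> inv.simps by (intro exI[of _ us] exI) auto
  next
    case (inc_wrap b a s)
    then obtain us vs j c where *: "t = tape (us @ vs)" "h = Suc (length us)" "j < gadgets x"
       "i = Suc (Suc j)" "x ! j = State s" "aux us = 0" "2 ^ length us * (aux vs + 1) = c + 1"
       "ready (us @ vs)" "reach (cur (us @ vs), a)" "lookup (length (us @ vs)) c (cur (us @ vs)) j"
      using I by auto
    have vs: "vs = []"
      using inc_wrap * by (cases vs) auto
    \<comment> \<open>This excludes the first alternative of \<open>lookup\<close>, which at an
      overflow would read \<open>2 ^ length us + cur us = j\<close>; the second one identifies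
      \<open>j\<close> as the current index.\<close>
    have "j < 2 ^ length us"
      using *(3,8) column_list_less(1)[of us] by (auto simp: ready_def vs)
    then have j: "cur us = j" using *(7,10) by (auto simp: vs lookup_def)
    have "reach (j, b)" using \<open>b = a \<or> _\<close> reach_tunnel[OF _ *(3,5)] *(9) j by (auto simp: vs)
    then have "boundary_inv (St (Some b)) i us"
      using * j by (auto simp: vs lookup_def)
    moreover have "t' = tape us" "h' = length us" "i' = i"
      using inc_wrap * assms(3) by (auto simp: eqs vs fun_upd_idem)
    ultimately show ?thesis
      unfolding \<open>q' = _\<close> inv.simps by (intro exI[of _ us] exI[of _ "[]"]) auto
  next
    case (read g md)
    then obtain w ps where w: "t = tape w" "h = 0" "parsed ps [] i" "ready w" "stage_inv True g ps w"
      using I by auto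
    have "t' = tape ([] @ w)" "h' = Suc (length [])" "i' = i"
      using w read assms(3) by (auto simp: eqs fun_upd_idem)
    then show ?thesis
      unfolding \<open>q' = _\<close> inv.simps using w stage_inv_mode[OF w(5)]
      by (intro exI[of _ "[]"] exI[of _ w] exI[of _ ps]) auto
  next
    case (last a f)
    then obtain w ps where w: "t = tape w" "h = 0" "parsed ps [] i" "ready w" "stage_inv True (Fst a f) ps w"
       "aux w + cur w + 1 = 2 ^ length w"
      using I by auto
    have t': "t' = tape w" "h' = 0" using w last by (auto simp: eqs fun_upd_idem)
    show ?thesis
    proof (cases f)
      case False
      then show ?thesis using last w t' by auto
    next
      case True
      have goal: goal_reached using w(5) True by simp
      obtain p q qs where ps: "ps = p # q # qs" "even (length qs)"
        using w(5) by (cases ps; cases "tl ps") auto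
      \<comment> \<open>At the right end marker nothing is left unread, so the parsed locations
        account for the whole input.\<close>
      have "locs x = encode_locs ps"
        using w(3) input_cell_Right_EndD \<open>input_cell x i = _\<close> by (auto simp: parsed_def)
      then obtain S where S: "x = encode S" "loc_list S = ps" "length (initial_states S) = gadgets x"
        using encode_decompose[of x p q qs] ps by auto
      have "wf_system S" unfolding wf_system_loc_list S(2,3) using w(3) by (simp add: parsed_def)
      then have "static_reach G S (goal_loc S)"
        using goal S(1) unfolding goal_reached_def by blast
      then have "inv Acc i' t' h'" unfolding inv.simps using t' S(1) \<open>wf_system S\<close> by blast
      then show ?thesis using True last by simp
    qed
  next
    case (read_bit md b k g lt ok m dd)
    then obtain us vs ps where *: "t = tape (us @ vs)" "h = Suc (length us)"
      "parsed ps (map Bit (map (track md) us)) i" "ready (us @ vs)" "stage_inv md g ps (us @ vs)"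
      "lt = (nat_of_bits (map (track md) us) < lim us)"
      using I by auto
    obtain vs' where vs: "vs = (m, k, dd) # vs'"
      using read_bit * by (cases vs) auto
    let ?v = "put md b (m, k, dd)"
    have "b = k" if md using read_bit that by simp
    note put = map_put_track[of md b k, OF this]
    let ?us = "us @ [?v]"
    have bs: "map (track md) ?us = map (track md) us @ [b]"
      using put(1) by (simp del: put.simps)
    have "parsed ps (map Bit (map (track md) us @ [b])) i'"
      using parsed_input[OF *(3) \<open>input_cell x i = _\<close>] by (simp add: eqs read_bit)
    moreover have "ready (?us @ vs')" "stage_inv md g ps (?us @ vs')"
      using *(4,5) put by (simp_all add: vs del: put.simps)
    moreover have "(if b = m then lt else m) = (nat_of_bits (map (track md) us @ [b]) < lim ?us)"
      using put(4) *(6) nat_of_bits_less_append[of "map (track md) us" "map fst us" b m]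
      by (simp add: lim_def del: put.simps column_list_simps)
    moreover have "t' = tape (?us @ vs')" "h' = Suc (length ?us)"
      using \<open>u = _\<close> \<open>e = _\<close> *(1,2) by (simp_all add: eqs vs del: put.simps)
    ultimately show ?thesis
      unfolding \<open>q' = _\<close> inv.simps
      by (intro exI[of _ ?us] exI[of _ vs'] exI[of _ ps] exI[of _ "map (track md) us @ [b]"] conjI)
        (simp_all only: bs, simp_all)
  next
    case (read_loc g md lt a)
    then obtain us vs ps bs where *: "t = tape (us @ vs)" "h = Suc (length us)"
      "parsed ps (map Bit bs) i" "ready (us @ vs)" "stage_inv md g ps (us @ vs)"
      "map (track md) us = bs" "lt = (nat_of_bits bs < lim us)" "True = (bs = [] \<or> last bs)"
      using I unfolding \<open>q = _\<close> inv.simps by blast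
    have "(encode_loc (nat_of_bits bs, a) :: ('l, 's) letter list) = map Bit bs @ [Loc a]"
      using binary_nat_of_bits[of bs] *(8) by simp
    then have "parsed ps (encode_loc (nat_of_bits bs, a)) i'"
      using parsed_input[OF *(3) \<open>input_cell x i = _\<close>] by (simp add: eqs read_loc del: encode_loc.simps)
    moreover have "t' = tape (us @ vs)" "h' = h" using read_loc * by (auto simp: eqs fun_upd_idem)
    ultimately show ?thesis
      unfolding \<open>q' = _\<close> inv.simps using * by blast
  next
    case (pad md k g lt a m dd)
    then obtain us vs ps n where *: "t = tape (us @ vs)" "h = Suc (length us)"
      "parsed ps (encode_loc (n, a)) i" "ready (us @ vs)" "stage_inv md g ps (us @ vs)"
      "n = nat_of_bits (map (track md) us)" "lt = (n < lim us)"
      using I by auto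
    obtain vs' where vs: "vs = (m, k, dd) # vs'"
      using pad * by (cases vs) auto
    let ?v = "put md False (m, k, dd)"
    have "False = k" if md using pad that by simp
    note put = map_put_track[of md False k, OF this]
    let ?us = "us @ [?v]"
    have bs: "map (track md) ?us = map (track md) us @ [False]"
      using put(1) by (simp del: put.simps)
    moreover have "ready (?us @ vs')" "stage_inv md g ps (?us @ vs')"
      using *(4,5) put by (simp_all add: vs del: put.simps)
    moreover have n: "nat_of_bits (map (track md) us @ [False]) = n" by (simp add: horner_sum_append *(6))
    moreover have "(lt \<or> m) = (n < lim ?us)"
      using put(4) *(7) nat_of_bits_less_append[of "map (track md) us" "map fst us" False m]
      unfolding n *(6)[symmetric]
      by (auto simp: lim_def simp del: put.simps column_list_simps)
    moreover have "t' = tape (?us @ vs')" "h' = Suc (length ?us)" "i' = i"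
      using \<open>u = _\<close> \<open>e = _\<close> \<open>d = _\<close> *(1,2) assms(3) by (simp_all add: eqs vs del: put.simps)
    ultimately show ?thesis
      unfolding \<open>q' = _\<close> inv.simps using *(3)
      by (intro exI[of _ ?us] exI[of _ vs'] exI[of _ ps] exI[of _ n]) (auto simp del: put.simps)
  next
    case (pad_end g md a f g')
    then obtain us vs ps n where *: "t = tape (us @ vs)" "h = Suc (length us)"
      "parsed ps (encode_loc (n, a)) i" "ready (us @ vs)" "stage_inv md g ps (us @ vs)"
      "n = nat_of_bits (map (track md) us)" "n < lim us"
      using I by auto
    have vs: "vs = []"
      using pad_end * by (cases vs) auto
    have "parsed (ps @ [(n, a)]) [] i"
      using parsed_encode[OF *(3)] *(4,7) by (simp add: vs ready_def)
    moreover have "n = (if md then cur us else aux us)"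
      using *(6) by (simp add: cur_def aux_def)
    ultimately have "boundary_inv (Lc g') i (map f us)"
      using finish_inv[OF \<open>finish _ _ _ _ _\<close>] *(4,5) by (simp add: vs)
    moreover have "t' = tape us" "h' = length us" "i' = i"
      using pad_end * assms(3) by (auto simp: eqs vs fun_upd_idem)
    ultimately show ?thesis
      unfolding \<open>q' = _\<close> inv.simps by (intro exI[of _ us] exI[of _ "[]"]) auto
  next
    case (rewind f b v)
    then obtain us vs where *: "t = tape (us @ vs)" "h = length us" "boundary_inv b i (map f us @ vs)"
      using I by auto
    obtain us' where us: "us = us' @ [v]"
      using rewind * by (cases us rule: rev_cases) auto
    have "t' = tape (us' @ f v # vs)" "h' = length us'" "i' = i"
      using rewind * assms(3) by (auto simp: eqs us)
    then show ?thesis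
      unfolding \<open>q' = _\<close> inv.simps using * by (intro exI[of _ us'] exI) (auto simp: us)
  next
    case (rewind_end f b)
    then obtain us vs where *: "t = tape (us @ vs)" "h = length us" "boundary_inv b i (map f us @ vs)"
      using I by auto
    have us: "us = []"
      using rewind_end * by (cases us rule: rev_cases) auto
    show ?thesis
      using rewind_end * assms(3) by (auto simp: eqs us fun_upd_idem)
  next
    case (home a)
    then show ?thesis using I by (auto simp: eqs fun_upd_idem)
  next
    case (home_end a)
    then have "i = 0" by (auto simp: input_cell_def split: if_splits)
    then show ?thesis using I home_end by (auto simp: eqs fun_upd_idem lookup_def)
  qed
qed

end

section \<open>Completeness\<close>

definition pair_locs :: "((nat \<times> 'l) \<times> (nat \<times> 'l)) list \<Rightarrow> (nat \<times> 'l) list" where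
  "pair_locs es = concat (map (\<lambda>(p, q). [p, q]) es)"

context
  fixes G :: "('l, 's) gadget" and x :: "('l, 's) letter list"
begin

abbreviation run where
  "run \<equiv> (step1 (delta G) x)\<^sup>*\<^sup>*"

lemma run_step:
  assumes "delta G q c u q' d u' e" "input_cell x i = c" "t h = u"
    and "run (q', min (move_head d i) (length x + 1), t(h := u'), move_head e h) z"
  shows "run (q, i, t, h) z"
  using step1I[of "delta G" q x i t h q' d u' e] assms by (auto intro: converse_rtranclp_into_rtranclp)

section \<open>Rewinding and incrementing\<close>

lemma run_rewind:
  "i \<le> length x + 1 \<Longrightarrow> run (Rew f b, i, tape (us @ vs), length us) (At b, i, tape (map f us @ vs), 0)"
proof (induction us arbitrary: vs rule: rev_induct)
  case Nil
  then show ?case by - (rule run_step[OF rewind_end refl], auto simp: fun_upd_idem)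
next
  case (snoc u us)
  then show ?case
    using snoc.IH[of "f u # vs"] by - (rule run_step[OF rewind[where v = u] refl], auto)
qed

text \<open>The hypothesis means that all auxiliary bits in \<open>vs\<close> are ones, so the carry
  runs through to the blank. In the first pass, where \<open>r\<close> is \<open>None\<close>, the
  limit track changes too, hence the guarded equations.\<close>

lemma run_inc_carry:
  assumes "aux vs + 1 = 2 ^ length vs" "i \<le> length x + 1"
  shows "\<exists>vs'. length vs' = length vs \<and> aux vs' = 0 \<and> (r \<noteq> None \<longrightarrow> lim vs' = lim vs \<and> cur vs' = cur vs) \<and>
    run (Inc r s, i, tape (us @ vs), Suc (length us)) (Inc r s, i, tape (us @ vs'), Suc (length (us @ vs')))"
  using assms(1)
proof (induction vs arbitrary: us)
  case (Cons v vs)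
  obtain m k d where v: "v = (m, k, d)" by (cases v)
  have d: "d" "aux vs + 1 = 2 ^ length vs"
    using Cons.prems column_list_less(3)[of vs] by (cases d; simp add: v; presburger)+
  let ?v = "(r \<noteq> None \<and> m, k, False)"
  obtain vs' where vs': "length vs' = length vs" "aux vs' = 0" "r \<noteq> None \<longrightarrow> lim vs' = lim vs \<and> cur vs' = cur vs"
    "run (Inc r s, i, tape ((us @ [?v]) @ vs), Suc (length (us @ [?v])))
      (Inc r s, i, tape ((us @ [?v]) @ vs'), Suc (length ((us @ [?v]) @ vs')))"
    using Cons.IH[OF d(2)] by metis
  have "run (Inc r s, i, tape (us @ v # vs), Suc (length us)) (Inc r s, i, tape (us @ ?v # vs'), Suc (length (us @ ?v # vs')))"
    using vs'(4) assms(2) by - (rule run_step[OF inc_carry[where m = m and k = k] refl], auto simp: v d)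
  then show ?case using vs' by (intro exI[of _ "?v # vs'"]) (auto simp: v)
qed auto

lemma run_inc_stop:
  assumes "aux vs + 1 < 2 ^ length vs" "i \<le> length x + 1"
  shows "\<exists>vs'. length vs' = length vs \<and> aux vs' = aux vs + 1 \<and> (r \<noteq> None \<longrightarrow> lim vs' = lim vs \<and> cur vs' = cur vs) \<and>
    run (Inc r s, i, tape (us @ vs), Suc (length us)) (At (St r), i, tape (us @ vs'), 0)"
  using assms(1)
proof (induction vs arbitrary: us)
  case (Cons v vs)
  obtain m k d where v: "v = (m, k, d)" by (cases v)
  show ?case
  proof (cases d)
    case True
    then have "aux vs + 1 < 2 ^ length vs" using Cons.prems by (simp add: v)
    let ?v = "(r \<noteq> None \<and> m, k, False)"
    obtain vs' where vs': "length vs' = length vs" "aux vs' = aux vs + 1" "r \<noteq> None \<longrightarrow> lim vs' = lim vs \<and> cur vs' = cur vs"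
      "run (Inc r s, i, tape ((us @ [?v]) @ vs), Suc (length (us @ [?v]))) (At (St r), i, tape ((us @ [?v]) @ vs'), 0)"
      using Cons.IH[OF \<open>aux vs + 1 < 2 ^ length vs\<close>] by metis
    have "run (Inc r s, i, tape (us @ v # vs), Suc (length us)) (At (St r), i, tape (us @ ?v # vs'), 0)"
      using vs'(4) assms(2) by - (rule run_step[OF inc_carry[where m = m and k = k] refl], auto simp: v True)
    then show ?thesis using vs' True by (intro exI[of _ "?v # vs'"]) (auto simp: v)
  next
    case False
    let ?v = "(r = None \<or> m, k, True)"
    have "run (Inc r s, i, tape (us @ v # vs), Suc (length us)) (At (St r), i, tape (us @ ?v # vs), 0)"
      using run_rewind[OF assms(2), of id "St r" us "?v # vs"] assms(2)
      by - (rule run_step[OF inc_stop[where m = m and k = k] refl], auto simp: v False)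
    then show ?thesis using False by (intro exI[of _ "?v # vs"]) (auto simp: v)
  qed
qed auto

lemma run_state:
  assumes "j < gadgets x" "x ! j = State s"
    and "run (Inc r s, Suc (Suc j), tape w, Suc 0) z"
  shows "run (At (St r), Suc j, tape w, 0) z"
proof (rule run_step[OF delta.state])
  show "input_cell x (Suc j) = Sym (State s)"
    using assms(1,2) gadgets_le[of x] by (simp add: input_cell_def)
qed (use assms gadgets_le[of x] in \<open>auto simp: fun_upd_idem\<close>)

lemma aux_le: "aux w + 1 < 2 ^ length w \<or> aux w + 1 = 2 ^ length w"
  using column_list_less(3)[of w] by linarith

text \<open>Nothing is claimed about the content of \<open>w\<close>: the soundness invariant,
  applied to this run, supplies it.\<close>

lemma run_count:
  assumes "j \<le> gadgets x"
  shows "\<exists>w. run (At (St None), 1, tape [], 0) (At (St None), Suc j, tape w, 0)"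
  using assms
proof (induction j)
  case (Suc j)
  then obtain w where w: "run (At (St None), 1, tape [], 0) (At (St None), Suc j, tape w, 0)" by auto
  obtain s where s: "x ! j = State s" using gadgets_nth[of j x] Suc.prems by auto
  have j: "j < gadgets x" "Suc (Suc j) \<le> length x + 1" using Suc.prems gadgets_le[of x] by auto
  have "\<exists>w'. run (Inc None s, Suc (Suc j), tape w, Suc 0) (At (St None), Suc (Suc j), tape w', 0)"
  proof (cases "aux w + 1 < 2 ^ length w")
    case True
    then show ?thesis using run_inc_stop[OF True j(2), of None s "[]"] by auto
  next
    case False
    then obtain w' where w': "run (Inc None s, Suc (Suc j), tape w, Suc 0) (Inc None s, Suc (Suc j), tape w', Suc (length w'))"
      using run_inc_carry[of w "Suc (Suc j)" None s "[]"] aux_le[of w] j(2) by auto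
    have "run (Inc None s, Suc (Suc j), tape w', Suc (length w'))
       (At (St None), Suc (Suc j), tape (w' @ [(True, False, True)]), 0)"
      using run_rewind[OF j(2), of id "St None" w' "[(True, False, True)]"] j(2)
      by - (rule run_step[OF inc_extend refl], auto)
    then show ?thesis using w' by (meson rtranclp_trans)
  qed
  then show ?case using run_state[OF j(1) s] w by (meson rtranclp_trans)
qed auto

text \<open>Under \<open>lookup\<close> the counter overflows at \<open>j\<close> exactly if
  \<open>j\<close> is the current index, the only place where \<open>b\<close> may differ from
  \<open>a\<close>. The limit yields \<open>j < 2 ^ length w\<close>, which rules out a second
  overflow.\<close>

lemma run_lookup_step:
  assumes "j < gadgets x" "x ! j = State s" "lim w = gadgets x" "lookup (length w) (aux w) (cur w) j"
    and "b = a \<or> (j = cur w \<and> (a, b, s') \<in> G s)"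
  shows "\<exists>w'. length w' = length w \<and> lim w' = lim w \<and> cur w' = cur w \<and> lookup (length w) (aux w') (cur w) (Suc j) \<and>
    run (At (St (Some a)), Suc j, tape w, 0) (At (St (Some b)), Suc (Suc j), tape w', 0)"
proof -
  have j: "Suc (Suc j) \<le> length x + 1" using assms(1) gadgets_le[of x] by auto
  have jw: "j < 2 ^ length w" using assms(1,3) column_list_less(1)[of w] by simp
  show ?thesis
  proof (cases "aux w + 1 < 2 ^ length w")
    case True
    then have "b = a" using assms(4,5) by (auto simp: lookup_def)
    then show ?thesis
      using run_inc_stop[OF True j, of "Some a" s "[]"] run_state[OF assms(1,2)] assms(4)
      by (fastforce simp: lookup_def)
  next
    case False
    then have w: "aux w + 1 = 2 ^ length w" using aux_le[of w] by auto
    then obtain w' where w': "length w' = length w" "aux w' = 0" "lim w' = lim w" "cur w' = cur w"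
      "run (Inc (Some a) s, Suc (Suc j), tape w, Suc 0) (Inc (Some a) s, Suc (Suc j), tape w', Suc (length w'))"
      using run_inc_carry[OF w j, of "Some a" s "[]"] by auto
    have "run (Inc (Some a) s, Suc (Suc j), tape w', Suc (length w')) (At (St (Some b)), Suc (Suc j), tape w', 0)"
      using run_rewind[OF j, of id "St (Some b)" w' "[]"] j assms(5)
      by - (rule run_step[OF inc_wrap[where b = b] refl], auto simp: fun_upd_idem)
    then have "run (At (St (Some a)), Suc j, tape w, 0) (At (St (Some b)), Suc (Suc j), tape w', 0)"
      using w'(5) run_state[OF assms(1,2)] by (meson rtranclp_trans)
    moreover have "lookup (length w) (aux w') (cur w) (Suc j)"
      using assms(4) w w'(2) jw by (auto simp: lookup_def)
    ultimately show ?thesis using w' by blast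
  qed
qed

lemma run_lookup:
  assumes "j \<le> j'" "j' \<le> gadgets x" "lim w = gadgets x" "lookup (length w) (aux w) (cur w) j"
  shows "\<exists>w'. length w' = length w \<and> lim w' = lim w \<and> cur w' = cur w \<and> lookup (length w) (aux w') (cur w) j' \<and>
    run (At (St (Some a)), Suc j, tape w, 0) (At (St (Some a)), Suc j', tape w', 0)"
  using assms(1,2)
proof (induction j' rule: dec_induct)
  case base
  then show ?case using assms by blast
next
  case (step n)
  then obtain w' where w': "length w' = length w" "lim w' = lim w" "cur w' = cur w"
      "lookup (length w) (aux w') (cur w) n"
      "run (At (St (Some a)), Suc j, tape w, 0) (At (St (Some a)), Suc n, tape w', 0)" by auto
  obtain s where "x ! n = State s" using gadgets_nth[of n x] step.prems by auto
  then show ?case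
    using run_lookup_step[of n s w' a a] w' assms(3) step.prems by (fastforce intro: rtranclp_trans)
qed

lemma run_no_state:
  "run (At (St r), Suc (gadgets x), tape w, 0) (At (Lc (Start r)), Suc (gadgets x), tape w, 0)"
proof (rule run_step[OF delta.no_state refl])
  show "input_cell x (Suc (gadgets x)) \<noteq> Sym (State s)" for s
    using gadgets_nth_not[of x] by (auto simp: input_cell_def)
qed (use gadgets_le[of x] in \<open>auto simp: fun_upd_idem\<close>)

section \<open>Reading one location\<close>

lemma run_pad:
  assumes "finish g md a f g'" "0 < lim vs \<or> lt" "md \<Longrightarrow> cur vs = 0" "i \<le> length x + 1"
  shows "\<exists>vs'. length vs' = length vs \<and> lim vs' = lim vs \<and> cur vs' = cur vs \<and>
      (if md then vs' = vs else aux vs' = 0) \<and>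
      run (Pad g md lt a, i, tape (us @ vs), Suc (length us)) (Rew f (Lc g'), i, tape (us @ vs'), length (us @ vs'))"
  using assms(2,3)
proof (induction vs arbitrary: us lt)
  case Nil
  have "run (Pad g md True a, i, tape us, Suc (length us)) (Rew f (Lc g'), i, tape us, length us)"
    using assms(4) by - (rule run_step[OF pad_end[OF assms(1)] refl], auto simp: fun_upd_idem)
  then show ?case using Nil by auto
next
  case (Cons v vs)
  obtain m k d where v: "v = (m, k, d)" by (cases v)
  let ?v = "put md False v"
  have "0 < lim vs \<or> (lt \<or> m)" "md \<Longrightarrow> cur vs = 0" and k: "md \<Longrightarrow> \<not> k"
    using Cons.prems by (auto simp: v of_bool_def split: if_splits)
  then obtain vs' where vs': "length vs' = length vs" "lim vs' = lim vs" "cur vs' = cur vs"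
      "if md then vs' = vs else aux vs' = 0"
      "run (Pad g md (lt \<or> m) a, i, tape ((us @ [?v]) @ vs), Suc (length (us @ [?v])))
        (Rew f (Lc g'), i, tape ((us @ [?v]) @ vs'), length ((us @ [?v]) @ vs'))"
    using Cons.IH[of "lt \<or> m" "us @ [?v]"] by blast
  have "run (Pad g md lt a, i, tape (us @ v # vs), Suc (length us))
       (Rew f (Lc g'), i, tape (us @ ?v # vs'), length (us @ ?v # vs'))"
    using vs'(5) assms(4)
    by - (rule run_step[OF pad[OF k, where m = m and d = d] refl], auto simp: v simp del: put.simps)
  then show ?case using vs' by (intro exI[of _ "?v # vs'"]) (auto simp: v)
qed

text \<open>Generalised for induction over the columns: \<open>k\<close> is the unread rest of the
  index and \<open>vs\<close> the columns still ahead. With \<open>lt\<close> set, the lower bits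
  already decide in favour of the index, so \<open>k\<close> may equal the rest of the
  limit.\<close>

lemma run_Rd:
  assumes "finish g md a f g'" "k < lim vs + of_bool lt" "md \<Longrightarrow> cur vs = k" "k = 0 \<Longrightarrow> ok"
    and "drop j x = map Bit (binary k) @ Loc a # y"
  shows "\<exists>vs'. length vs' = length vs \<and> lim vs' = lim vs \<and> cur vs' = cur vs \<and>
      (if md then vs' = vs else aux vs' = k) \<and>
      run (Rd g md lt ok, Suc j, tape (us @ vs), Suc (length us))
        (Rew f (Lc g'), Suc (j + length (binary k) + 1), tape (us @ vs'), length (us @ vs'))"
  using assms(2-)
proof (induction vs arbitrary: us lt ok k j)
  case Nil
  then have k: "k = 0" "lt" "ok" by (cases lt; simp)+
  then have d: "drop j x = Loc a # y" using Nil.prems by (simp add: binary.simps)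
  note c = input_cell_drop[OF d]
  have "run (Rd g md lt ok, Suc j, tape us, Suc (length us)) (Rew f (Lc g'), Suc (Suc j), tape us, length us)"
    using k c run_pad[OF assms(1), of "[]" True "Suc (Suc j)" us]
    by (auto intro!: run_step[OF read_loc] simp: fun_upd_idem)
  then show ?case by (simp add: k binary.simps)
next
  case (Cons v vs)
  obtain m c d where v: "v = (m, c, d)" by (cases v)
  show ?case
  proof (cases "k = 0")
    case True
    then have d: "drop j x = Loc a # y" using Cons.prems by (simp add: binary.simps)
    note c = input_cell_drop[OF d]
    have "0 < lim (v # vs) \<or> lt" using Cons.prems(1) True by (cases lt) auto
    then obtain vs' where vs': "length vs' = length (v # vs)" "lim vs' = lim (v # vs)" "cur vs' = cur (v # vs)"
      "if md then vs' = v # vs else aux vs' = 0"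
      "run (Pad g md lt a, Suc (Suc j), tape (us @ v # vs), Suc (length us))
         (Rew f (Lc g'), Suc (Suc j), tape (us @ vs'), length (us @ vs'))"
      using run_pad[OF assms(1), of "v # vs" lt "Suc (Suc j)" us] Cons.prems(2) True c by auto
    have "run (Rd g md lt ok, Suc j, tape (us @ v # vs), Suc (length us))
         (Rew f (Lc g'), Suc (Suc j), tape (us @ vs'), length (us @ vs'))"
      using vs'(5) c Cons.prems(3) True by (auto intro!: run_step[OF read_loc] simp: fun_upd_idem)
    then show ?thesis using vs' by (intro exI[of _ vs']) (simp add: True binary.simps)
  next
    case False
    let ?b = "odd k" and ?k = "k div 2"
    let ?lt = "if ?b = m then lt else m"
    let ?v = "put md ?b v"
    have b: "binary k = ?b # binary ?k" using False by (subst binary.simps) simp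
    have d: "drop j x = Bit ?b # map Bit (binary ?k) @ Loc a # y" using Cons.prems(4) by (simp add: b)
    note i = input_cell_drop[OF d]
    have lt: "?k < lim vs + of_bool ?lt" 
      using Cons.prems(1) by (auto simp: v of_bool_def split: if_splits) presburger+
    have cc: "cur vs = ?k" "?b = c" if md
      using Cons.prems(2)[OF that] by (auto simp: v of_bool_def split: if_splits)
    have ok: "?k = 0 \<Longrightarrow> ?b" using False by presburger
    obtain vs' where vs': "length vs' = length vs" "lim vs' = lim vs" "cur vs' = cur vs"
      "if md then vs' = vs else aux vs' = ?k"
      "run (Rd g md ?lt ?b, Suc (Suc j), tape ((us @ [?v]) @ vs), Suc (length (us @ [?v])))
        (Rew f (Lc g'), Suc (Suc j + length (binary ?k) + 1), tape ((us @ [?v]) @ vs'), length ((us @ [?v]) @ vs'))"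
      using Cons.IH[OF lt cc(1) ok, of "Suc j" "us @ [?v]"] i by blast
    have "run (Rd g md lt ok, Suc j, tape (us @ v # vs), Suc (length us))
        (Rew f (Lc g'), Suc (j + length (binary k) + 1), tape (us @ ?v # vs'), length (us @ ?v # vs'))"
      using vs'(5) i
      by - (rule run_step[OF read_bit[OF cc(2), where m = m and d = d]], auto simp: v b simp del: put.simps)
    then show ?thesis using vs' cc by (intro exI[of _ "?v # vs'"]) (auto simp: v)
  qed
qed

lemma run_read:
  assumes "finish g md a f g'" "k < lim w" "md \<Longrightarrow> cur w = k"
    and "drop j x = encode_loc (k, a) @ y"
  obtains w' where "length w' = length w" "lim w' = lim w" "cur w' = cur w"
      "if md then w' = w else aux w' = k"
      "drop (j + length (encode_loc (k, a) :: ('l, 's) letter list)) x = y"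
      "run (At (Lc g), Suc j, tape w, 0)
        (At (Lc g'), Suc (j + length (encode_loc (k, a) :: ('l, 's) letter list)), tape (map f w'), 0)"
proof -
  let ?j = "j + length (binary k) + 1"
  obtain w' where w': "length w' = length w" "lim w' = lim w" "cur w' = cur w"
      "if md then w' = w else aux w' = k"
      "run (Rd g md False True, Suc j, tape w, Suc 0) (Rew f (Lc g'), Suc ?j, tape w', length w')"
    using run_Rd[OF assms(1), of k w False True j y "[]"] assms(2-) by auto
  have j: "?j \<le> length x" using arg_cong[OF assms(4), of length] by simp
  have "drop (length (encode_loc (k, a) :: ('l, 's) letter list)) (drop j x) = y" unfolding assms(4) by simp
  then have y: "drop (j + length (encode_loc (k, a) :: ('l, 's) letter list)) x = y"
    by (simp add: add_ac)
  have "run (Rew f (Lc g'), Suc ?j, tape w', length w') (At (Lc g'), Suc ?j, tape (map f w'), 0)"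
    using run_rewind[of "Suc ?j" f "Lc g'" w' "[]"] j by auto
  then have "run (Rd g md False True, Suc j, tape w, Suc 0) (At (Lc g'), Suc ?j, tape (map f w'), 0)"
    using w'(5) by (meson rtranclp_trans)
  then have "run (At (Lc g), Suc j, tape w, 0) (At (Lc g'), Suc ?j, tape (map f w'), 0)"
    using j by - (rule run_step[OF read refl], auto simp: fun_upd_idem)
  then show ?thesis using that[OF w'(1-4) y] by simp
qed

lemma run_inv:
  assumes "run (Begin, 0, \<lambda>_. Blank, 0) (q, i, t, h)"
  shows "inv G x q i t h \<and> i \<le> length x + 1"
  using assms
proof (induction "(q, i, t, h)" arbitrary: q i t h rule: rtranclp_induct)
  case (step c)
  obtain q' i' t' h' where c: "c = (q', i', t', h')" by (metis surj_pair)
  have "i \<le> length x + 1" using step(2) by (auto elim: step1.cases)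
  then show ?case using step c inv_step by blast
qed simp

section \<open>Passing over connections\<close>

definition standing :: "nat \<Rightarrow> column list \<Rightarrow> bool" where
  "standing i w \<longleftrightarrow> lim w = gadgets x \<and> cur w = i \<and> Suc (aux w + cur w) = 2 ^ length w"

lemma standing_restore: "standing i (map restore w) \<longleftrightarrow> lim w = gadgets x \<and> cur w = i"
  by (auto simp: standing_def)

lemma standing_commit: "standing i (map commit w) \<longleftrightarrow> lim w = gadgets x \<and> aux w = i"
  by (auto simp: standing_def)

text \<open>Both locations are read in store mode, which takes any index in range; so a pair can be
  skipped even if the robot stands at one of its ends.\<close>

lemma run_ignore_pair:
  assumes "drop j x = encode_loc p @ encode_loc q @ y" "fst p < gadgets x" "fst q < gadgets x" "standing i w"
  shows "\<exists>j' w'. standing i w' \<and> drop j' x = y \<and>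
     run (At (Lc (Fst a f)), Suc j, tape w, 0) (At (Lc (Fst a f)), Suc j', tape w', 0)"
proof -
  have w: "lim w = gadgets x" "cur w = i" using assms(4) by (auto simp: standing_def)
  obtain k b l c where pq: "p = (k, b)" "q = (l, c)" by (metis surj_pair)
  obtain w1 j1 where 1: "lim w1 = lim w" "cur w1 = cur w" "drop j1 x = encode_loc q @ y"
    "run (At (Lc (Fst a f)), Suc j, tape w, 0) (At (Lc (Snd a f (Some b))), Suc j1, tape (map id w1), 0)"
    by (rule run_read[OF finish.intros(6), of k w j b]) (use assms w in \<open>auto simp: pq\<close>)
  obtain w2 j2 where "lim w2 = lim w1" "cur w2 = cur w1" "drop j2 x = y"
    "run (At (Lc (Snd a f (Some b))), Suc j1, tape w1, 0) (At (Lc (Fst a f)), Suc j2, tape (map restore w2), 0)"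
    by (rule run_read[OF finish.intros(9), of l w1 j1 c]) (use assms w 1 in \<open>auto simp: pq\<close>)
  then show ?thesis
    using 1 w by (intro exI[of _ j2] exI[of _ "map restore w2"]) (auto simp: standing_restore)
qed

lemma run_forward:
  assumes "drop j x = encode_loc (k, b) @ encode_loc (l, c) @ y" "k < gadgets x" "l < gadgets x" "standing k w"
  shows "\<exists>j' w'. standing l w' \<and> drop j' x = y \<and>
     run (At (Lc (Fst b f)), Suc j, tape w, 0) (At (Lc (Fst c f)), Suc j', tape w', 0)"
proof -
  have w: "lim w = gadgets x" "cur w = k" using assms(4) by (auto simp: standing_def)
  obtain w1 j1 where 1: "lim w1 = lim w" "drop j1 x = encode_loc (l, c) @ y"
    "run (At (Lc (Fst b f)), Suc j, tape w, 0) (At (Lc (Snd b f None)), Suc j1, tape (map id w1), 0)"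
    by (rule run_read[OF finish.intros(5), of k w j b]) (use assms w in auto)
  obtain w2 j2 where "lim w2 = lim w1" "aux w2 = l" "drop j2 x = y"
    "run (At (Lc (Snd b f None)), Suc j1, tape w1, 0) (At (Lc (Fst c f)), Suc j2, tape (map commit w2), 0)"
    by (rule run_read[OF finish.intros(7), of l w1 j1 c]) (use assms w 1 in auto)
  then show ?thesis
    using 1 w by (intro exI[of _ j2] exI[of _ "map commit w2"]) (auto simp: standing_commit)
qed

text \<open>The first end is stored before it is known whether the second one matches; this guess is
  what allows a connection to be used against its listed order.\<close>

lemma run_backward:
  assumes "drop j x = encode_loc (k, b) @ encode_loc (l, c) @ y" "k < gadgets x" "l < gadgets x" "standing l w"
  shows "\<exists>j' w'. standing k w' \<and> drop j' x = y \<and>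
     run (At (Lc (Fst c f)), Suc j, tape w, 0) (At (Lc (Fst b f)), Suc j', tape w', 0)"
proof -
  have w: "lim w = gadgets x" "cur w = l" using assms(4) by (auto simp: standing_def)
  obtain w1 j1 where 1: "lim w1 = lim w" "cur w1 = cur w" "aux w1 = k" "drop j1 x = encode_loc (l, c) @ y"
    "run (At (Lc (Fst c f)), Suc j, tape w, 0) (At (Lc (Snd c f (Some b))), Suc j1, tape (map id w1), 0)"
    by (rule run_read[OF finish.intros(6), of k w j b]) (use assms w in auto)
  obtain w2 j2 where "w2 = w1" "drop j2 x = y"
    "run (At (Lc (Snd c f (Some b))), Suc j1, tape w1, 0) (At (Lc (Fst b f)), Suc j2, tape (map commit w2), 0)"
    by (rule run_read[OF finish.intros(8), of l w1 j1 c]) (use assms w 1 in auto)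
  then show ?thesis
    using 1 w by (intro exI[of _ j2] exI[of _ "map commit w2"]) (auto simp: standing_commit)
qed

lemma run_ignore:
  assumes "drop j x = encode_locs (pair_locs es) @ y" "\<forall>p \<in> set (pair_locs es). fst p < gadgets x" "standing i w"
  shows "\<exists>j' w'. standing i w' \<and> drop j' x = y \<and>
     run (At (Lc (Fst a f)), Suc j, tape w, 0) (At (Lc (Fst a f)), Suc j', tape w', 0)"
  using assms
proof (induction es arbitrary: j w)
  case Nil
  then show ?case by (auto simp: pair_locs_def)
next
  case (Cons e es)
  obtain p q where e: "e = (p, q)" by (cases e)
  obtain j1 w1 where 1: "standing i w1" "drop j1 x = encode_locs (pair_locs es) @ y"
     "run (At (Lc (Fst a f)), Suc j, tape w, 0) (At (Lc (Fst a f)), Suc j1, tape w1, 0)"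
    using run_ignore_pair[of j p q "encode_locs (pair_locs es) @ y" i w a f] Cons.prems
    by (auto simp: e pair_locs_def)
  obtain j2 w2 where "standing i w2" "drop j2 x = y"
     "run (At (Lc (Fst a f)), Suc j1, tape w1, 0) (At (Lc (Fst a f)), Suc j2, tape w2, 0)"
    using Cons.IH[OF 1(2) _ 1(1)] Cons.prems(2) by (auto simp: e pair_locs_def)
  then show ?case using rtranclp_trans[OF 1(3)] by blast
qed

section \<open>Complete passes over an encoded system\<close>

lemma run_home_left: "run (Home a, i, tape w, 0) (Home a, 0, tape w, 0)"
proof (induction i rule: less_induct)
  case (less i)
  show ?case
  proof (cases "i = 0")
    case False
    then have "input_cell x i \<noteq> Left_End" by (auto simp: input_cell_def)
    then show ?thesis
      using less.IH[of "min (i - 1) (length x + 1)"] False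
      by - (rule run_step[OF home refl refl], auto simp: fun_upd_idem)
  qed simp
qed

lemma run_last:
  assumes "drop j x = []"
  shows "\<exists>i. run (At (Lc (Fst a f)), Suc j, tape w, 0) (if f then Acc else Home a, i, tape w, 0)"
  using assms
  by - (rule exI, rule run_step[OF delta.last], auto simp: input_cell_def fun_upd_idem)

lemma run_home:
  assumes "drop j x = []"
  shows "run (At (Lc (Fst a False)), Suc j, tape w, 0) (At (St (Some a)), 1, tape w, 0)"
proof -
  have "run (Home a, 0, tape w, 0) (At (St (Some a)), 1, tape w, 0)"
    by (rule run_step[OF home_end]) (auto simp: input_cell_def fun_upd_idem)
  then show ?thesis
    using run_last[OF assms, of a False w] run_home_left[of a _ w] by (auto intro: rtranclp_trans)
qed

text \<open>These positions can be held at the start of a later pass. Their closure under static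
  edges gives completeness with one edge per pass, although a pass may follow several.\<close>

definition hub :: "nat \<times> 'l \<Rightarrow> bool" where
  "hub p \<longleftrightarrow> (\<exists>w. standing (fst p) w \<and>
     run (Begin, 0, \<lambda>_. Blank, 0) (At (St (Some (snd p))), 1, tape w, 0))"

context
  fixes S :: "('l, 's) system"
  assumes x: "x = encode S" and wf: "wf_system S"
begin

lemma gadgets_S: "gadgets x = length (initial_states S)"
  by (simp add: x)

lemma less_gadgets:
  "fst (start_loc S) < gadgets x" "fst (goal_loc S) < gadgets x"
  "p \<in> set (pair_locs (connections S)) \<Longrightarrow> fst p < gadgets x"
  using wf unfolding wf_system_loc_list gadgets_S by (simp_all add: loc_list_def flip: pair_locs_def)

lemma drop_gadgets: "drop (gadgets x) x =
    encode_loc (start_loc S) @ encode_loc (goal_loc S) @ encode_locs (pair_locs (connections S))"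
  using locs_encode[of S] unfolding x[symmetric] by (simp add: locs_def loc_list_def pair_locs_def)

lemma hub_scan:
  assumes "hub (i, a)" "b = a \<or> i < gadgets x \<and> (\<exists>s'. (a, b, s') \<in> G (initial_states S ! i))"
  shows "\<exists>w. lim w = gadgets x \<and> cur w = i \<and>
    run (Begin, 0, \<lambda>_. Blank, 0) (At (Lc (Start (Some b))), Suc (gadgets x), tape w, 0)"
proof -
  obtain w where w: "lim w = gadgets x" "cur w = i" "lookup (length w) (aux w) (cur w) 0"
    "run (Begin, 0, \<lambda>_. Blank, 0) (At (St (Some a)), Suc 0, tape w, 0)"
    using assms(1) by (auto simp: hub_def standing_def lookup_def)
  have "\<exists>w'. lim w' = gadgets x \<and> cur w' = i \<and>
    run (At (St (Some a)), Suc 0, tape w, 0) (At (St (Some b)), Suc (gadgets x), tape w', 0)"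
  proof (cases "b = a")
    case True
    then show ?thesis using run_lookup[of 0 "gadgets x" w a] w by auto
  next
    case False
    then obtain s' where s': "i < gadgets x" "(a, b, s') \<in> G (initial_states S ! i)" using assms(2) by auto
    have xi: "x ! i = State (initial_states S ! i)"
      using s'(1) unfolding gadgets_S unfolding x encode_eq by (simp add: nth_append)
    obtain w1 where 1: "length w1 = length w" "lim w1 = lim w" "cur w1 = cur w" "lookup (length w) (aux w1) (cur w) i"
      "run (At (St (Some a)), Suc 0, tape w, 0) (At (St (Some a)), Suc i, tape w1, 0)"
      using run_lookup[of 0 i w a] w s'(1) by auto
    obtain w2 where 2: "length w2 = length w" "lim w2 = lim w" "cur w2 = cur w" "lookup (length w) (aux w2) (cur w) (Suc i)"
      "run (At (St (Some a)), Suc i, tape w1, 0) (At (St (Some b)), Suc (Suc i), tape w2, 0)"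
      using run_lookup_step[of i _ w1 b a s', OF s'(1) xi] w s'(2) 1 by auto
    obtain w3 where 3: "lim w3 = lim w" "cur w3 = cur w"
      "run (At (St (Some b)), Suc (Suc i), tape w2, 0) (At (St (Some b)), Suc (gadgets x), tape w3, 0)"
      using run_lookup[of "Suc i" "gadgets x" w2 b] w s'(1) 2 by auto
    show ?thesis using rtranclp_trans[OF rtranclp_trans[OF 1(5) 2(5)] 3(3)] 3(1,2) w(1,2) by auto
  qed
  then obtain w' where w': "lim w' = gadgets x" "cur w' = i"
    "run (At (St (Some a)), Suc 0, tape w, 0) (At (St (Some b)), Suc (gadgets x), tape w', 0)" by blast
  show ?thesis using rtranclp_trans[OF rtranclp_trans[OF w(4) w'(3)] run_no_state] w'(1,2) by blast
qed

lemma hub_pass: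
  assumes "hub (i, a)" "b = a \<or> i < gadgets x \<and> (\<exists>s'. (a, b, s') \<in> G (initial_states S ! i))"
    and "f \<Longrightarrow> goal_loc S = (i, b)"
  shows "\<exists>j w. standing i w \<and> drop j x = encode_locs (pair_locs (connections S)) \<and>
    run (Begin, 0, \<lambda>_. Blank, 0) (At (Lc (Fst b f)), Suc j, tape w, 0)"
proof -
  obtain w where w: "lim w = gadgets x" "cur w = i"
    "run (Begin, 0, \<lambda>_. Blank, 0) (At (Lc (Start (Some b))), Suc (gadgets x), tape w, 0)"
    using hub_scan[OF assms(1,2)] by blast
  obtain k c where s: "start_loc S = (k, c)" by (cases "start_loc S")
  obtain l d where g: "goal_loc S = (l, d)" by (cases "goal_loc S")
  obtain w1 j1 where 1: "lim w1 = lim w" "cur w1 = cur w"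
    "drop j1 x = encode_loc (l, d) @ encode_locs (pair_locs (connections S))"
    "run (At (Lc (Start (Some b))), Suc (gadgets x), tape w, 0) (At (Lc (Goal b)), Suc j1, tape (map restore w1), 0)"
    by (rule run_read[OF finish.intros(2), of k w "gadgets x" c])
      (use w drop_gadgets less_gadgets in \<open>auto simp: s g\<close>)
  \<comment> \<open>The flag doubles as the reading mode: the goal is compared if \<open>f\<close>
    is to be set, and merely stored otherwise.\<close>
  have fin: "finish (Goal b) f d restore (Fst b f)" using assms(3) g by (cases f) (auto intro: finish.intros)
  obtain w2 j2 where "lim w2 = lim w1" "cur w2 = cur w1"
    "drop j2 x = encode_locs (pair_locs (connections S))"
    "run (At (Lc (Goal b)), Suc j1, tape (map restore w1), 0) (At (Lc (Fst b f)), Suc j2, tape (map restore w2), 0)"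
    by (rule run_read[OF fin, of l "map restore w1" j1])
      (use w 1 assms(3) less_gadgets in \<open>auto simp: g\<close>)
  then show ?thesis using w 1
    by (intro exI[of _ j2] exI[of _ "map restore w2"]) (auto simp: standing_restore)
qed

lemma hub_start: "hub (start_loc S)"
proof -
  obtain k c where s: "start_loc S = (k, c)" by (cases "start_loc S")
  obtain l d where g: "goal_loc S = (l, d)" by (cases "goal_loc S")
  have "run (Begin, 0, \<lambda>_. Blank, 0) (At (St None), 1, tape [], 0)"
    by (rule run_step[OF mark refl]) (auto simp: tape_Mark)
  then obtain w0 where "run (Begin, 0, \<lambda>_. Blank, 0) (At (Lc (Start None)), Suc (gadgets x), tape w0, 0)"
    using run_count[of "gadgets x"] run_no_state[of None] by (meson order_refl rtranclp_trans)
  moreover from run_inv[OF this] obtain w where w: "tape w0 = tape w" "ready x w" by auto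
  ultimately have r: "run (Begin, 0, \<lambda>_. Blank, 0) (At (Lc (Start None)), Suc (gadgets x), tape w, 0)" by simp
  have lim: "lim w = gadgets x" using w by (simp add: ready_def)
  obtain w1 j1 where 1: "lim w1 = lim w" "aux w1 = k"
    "drop j1 x = encode_loc (l, d) @ encode_locs (pair_locs (connections S))"
    "run (At (Lc (Start None)), Suc (gadgets x), tape w, 0) (At (Lc (Goal c)), Suc j1, tape (map commit w1), 0)"
    by (rule run_read[OF finish.intros(1), of k w "gadgets x" c])
      (use lim drop_gadgets less_gadgets in \<open>auto simp: s g\<close>)
  obtain w2 j2 where 2: "lim w2 = lim w1" "cur w2 = k"
    "drop j2 x = encode_locs (pair_locs (connections S))"
    "run (At (Lc (Goal c)), Suc j1, tape (map commit w1), 0) (At (Lc (Fst c False)), Suc j2, tape (map restore w2), 0)"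
    by (rule run_read[OF finish.intros(3), of l "map commit w1" j1 d])
      (use lim 1 less_gadgets in \<open>auto simp: g\<close>)
  then obtain j3 w3 where 3: "standing k w3" "drop j3 x = []"
    "run (At (Lc (Fst c False)), Suc j2, tape (map restore w2), 0) (At (Lc (Fst c False)), Suc j3, tape w3, 0)"
    using run_ignore[of j2 "connections S" "[]" k "map restore w2" c False] less_gadgets(3) lim 1
    by (auto simp: standing_restore)
  have "run (Begin, 0, \<lambda>_. Blank, 0) (At (St (Some c)), 1, tape w3, 0)"
    using r 1(4) 2(4) 3(3) run_home[OF 3(2), of c w3] by (meson rtranclp_trans)
  then show ?thesis using 3(1) by (auto simp: hub_def s)
qed

text \<open>A tunnel edge is followed while the State letters are scanned, a connection at its own
  pair; all other pairs of that pass are ignored.\<close>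

lemma hub_edge:
  assumes "hub p" "(p, q) \<in> static_edges G S"
  shows "hub q"
proof -
  obtain i a where p: "p = (i, a)" by (cases p)
  have "\<exists>j w. standing (fst q) w \<and> drop j x = [] \<and>
      run (Begin, 0, \<lambda>_. Blank, 0) (At (Lc (Fst (snd q) False)), Suc j, tape w, 0)"
  proof (cases "(p, q) \<in> set (connections S) \<union> (set (connections S))\<inverse>")
    case False
    then obtain b s' where q: "q = (i, b)" "i < gadgets x" "(a, b, s') \<in> G (initial_states S ! i)"
      using assms(2) p by (auto simp: static_edges_def gadgets_S)
    then obtain j w where "standing i w" "drop j x = encode_locs (pair_locs (connections S))"
      "run (Begin, 0, \<lambda>_. Blank, 0) (At (Lc (Fst b False)), Suc j, tape w, 0)"
      using hub_pass[of i a b False] assms p by blast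
    then show ?thesis
      using run_ignore[of j "connections S" "[]" i w b False] less_gadgets(3)
      by (auto simp: q intro: rtranclp_trans)
  next
    case True
    then obtain p' q' es1 es2 where es: "connections S = es1 @ (p', q') # es2"
      and pq: "p' = p \<and> q' = q \<or> p' = q \<and> q' = p"
      by (metis UnE converse.cases in_set_conv_decomp prod.inject)
    have pl: "pair_locs (connections S) = pair_locs es1 @ p' # q' # pair_locs es2"
      by (simp add: es pair_locs_def)
    then have less: "\<forall>p \<in> set (pair_locs es1). fst p < gadgets x" "\<forall>p \<in> set (pair_locs es2). fst p < gadgets x"
      "fst p' < gadgets x" "fst q' < gadgets x"
      using less_gadgets(3) by auto
    obtain j w where 0: "standing i w"
      "drop j x = encode_locs (pair_locs es1) @ encode_loc p' @ encode_loc q' @ encode_locs (pair_locs es2)"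
      "run (Begin, 0, \<lambda>_. Blank, 0) (At (Lc (Fst a False)), Suc j, tape w, 0)"
      using hub_pass[of i a a False] assms p by (auto simp: pl)
    obtain j1 w1 where 1: "standing i w1" "drop j1 x = encode_loc p' @ encode_loc q' @ encode_locs (pair_locs es2)"
      "run (At (Lc (Fst a False)), Suc j, tape w, 0) (At (Lc (Fst a False)), Suc j1, tape w1, 0)"
      using run_ignore[OF 0(2) less(1) 0(1)] by blast
    obtain j2 w2 where 2: "standing (fst q) w2" "drop j2 x = encode_locs (pair_locs es2)"
      "run (At (Lc (Fst a False)), Suc j1, tape w1, 0) (At (Lc (Fst (snd q) False)), Suc j2, tape w2, 0)"
      using pq
    proof
      assume "p' = p \<and> q' = q"
      then show ?thesis
        using that run_forward[of j1 i a "fst q" "snd q" _ w1 False] 1 less p by auto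
    next
      assume "p' = q \<and> q' = p"
      then show ?thesis
        using that run_backward[of j1 "fst q" "snd q" i a _ w1 False] 1 less p by auto
    qed
    obtain j3 w3 where "standing (fst q) w3" "drop j3 x = []"
      "run (At (Lc (Fst (snd q) False)), Suc j2, tape w2, 0) (At (Lc (Fst (snd q) False)), Suc j3, tape w3, 0)"
      using run_ignore[of j2 es2 "[]" "fst q" w2 "snd q" False] less(2) 2 by auto
    then show ?thesis using 0(3) 1(3) 2(3) by (meson rtranclp_trans)
  qed
  then show ?thesis unfolding hub_def using run_home by (meson rtranclp_trans)
qed

text \<open>One further pass suffices: the goal is compared with the position of the robot, and all
  connections are ignored up to the end of the input.\<close>

lemma run_accept:
  assumes "static_reach G S (goal_loc S)"
  shows "\<exists>i t h. run (Begin, 0, \<lambda>_. Blank, 0) (Acc, i, t, h)"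
proof -
  have "hub p" if "(start_loc S, p) \<in> (static_edges G S)\<^sup>*" for p
    using that by (induction rule: rtrancl_induct) (rule hub_start, rule hub_edge)
  then have "hub (goal_loc S)" using assms unfolding static_reach_def .
  then obtain j w where 1: "standing (fst (goal_loc S)) w" "drop j x = encode_locs (pair_locs (connections S))"
    "run (Begin, 0, \<lambda>_. Blank, 0) (At (Lc (Fst (snd (goal_loc S)) True)), Suc j, tape w, 0)"
    using hub_pass[of "fst (goal_loc S)" "snd (goal_loc S)" "snd (goal_loc S)" True] by auto
  then obtain j2 w2 where 2: "drop j2 x = []"
    "run (At (Lc (Fst (snd (goal_loc S)) True)), Suc j, tape w, 0)
      (At (Lc (Fst (snd (goal_loc S)) True)), Suc j2, tape w2, 0)"
    using run_ignore[of j "connections S" "[]" "fst (goal_loc S)" w "snd (goal_loc S)" True] less_gadgets(3) by auto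
  obtain i where "run (At (Lc (Fst (snd (goal_loc S)) True)), Suc j2, tape w2, 0) (Acc, i, tape w2, 0)"
    using run_last[OF 2(1), of "snd (goal_loc S)" True w2] by auto
  then show ?thesis using rtranclp_trans[OF rtranclp_trans[OF 1(3) 2(2)]] by blast
qed

end

section \<open>Space bound\<close>

lemma inv_space:
  assumes "inv G x q i t h"
  shows "\<exists>n. 2 ^ n \<le> 2 * length x + 1 \<and> h \<le> Suc n"
proof -
  have le: "gadgets x \<le> length x" by (rule gadgets_le)
  have r: "2 ^ length w \<le> 2 * length x + 1" if "ready x w" for w
    using that le by (auto simp: ready_def)
  have b: "2 ^ length w \<le> 2 * length x + 1" if "boundary_inv G x b i w" for b i w
    using that by (induction b i w rule: boundary_inv.induct) (use r le in \<open>auto simp: counted_def\<close>)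
  \<comment> \<open>Cell 0 holds the mark and the columns follow it, so the head gets at most to the
    first blank, one cell beyond the last column.\<close>
  show ?thesis
    using assms
  proof (induction q i t h rule: inv.induct)
    case (3 r s i t h)
    then obtain us vs :: "column list" and j where "h = Suc (length us)" "j < gadgets x"
      "2 ^ length (us @ vs) \<le> 2 * j + 1 \<or> ready x (us @ vs)" by (cases r) auto
    then show ?case using r[of "us @ vs"] le by (intro exI[of _ "length (us @ vs)"]) auto
  next
    case (4 g md lt ok i t h)
    then obtain us vs :: "column list" where "h = Suc (length us)" "ready x (us @ vs)" by auto
    then show ?case using r[of "us @ vs"] by (intro exI[of _ "length (us @ vs)"]) auto
  next
    case (5 g md lt a i t h)
    then obtain us vs :: "column list" where "h = Suc (length us)" "ready x (us @ vs)" by auto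
    then show ?case using r[of "us @ vs"] by (intro exI[of _ "length (us @ vs)"]) auto
  next
    case (6 f b' i t h)
    then obtain us vs where "h = length us" "boundary_inv G x b' i (map f us @ vs)" by auto
    then show ?case using b[OF \<open>boundary_inv G x b' i (map f us @ vs)\<close>]
      by (intro exI[of _ "length (us @ vs)"]) simp
  qed (auto intro: exI[of _ 0])
qed

end

text \<open>For \<open>n \<ge> 2\<close> the left side is at most \<open>log 2 (real n) + 4\<close>,
  and \<open>log 2 (real n) \<ge> 1\<close> absorbs the summand into the factor 5.\<close>

lemma log_space_bound: "(\<lambda>n. real (nat \<lfloor>log 2 (2 * real n + 1)\<rfloor> + 2)) \<in> O(\<lambda>n. log 2 (real n))"
proof (rule bigoI[of _ 5], rule eventually_sequentiallyI[of 2])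
  fix n :: nat assume n: "2 \<le> n"
  have "log 2 (2 * real n + 1) \<le> log 2 (4 * real n)" using n by (intro log_mono) auto
  also have "\<dots> = 2 + log 2 (real n)"
    using n log_mult[of 2 4 "real n"] log_of_power_eq[of 4 2 2] by simp
  finally have "log 2 (2 * real n + 1) \<le> 2 + log 2 (real n)" .
  moreover have "1 \<le> log 2 (real n)" using n by (simp add: le_log_iff)
  moreover have "0 \<le> log 2 (2 * real n + 1)" by (simp add: zero_le_log_cancel_iff)
  ultimately show "norm (real (nat \<lfloor>log 2 (2 * real n + 1)\<rfloor> + 2)) \<le> 5 * norm (log 2 (real n))"
    by simp linarith
qed

theorem theorem2p2:
  fixes G :: "('l::finite, 's::finite) gadget"
    and k :: nat
    and P :: "'l set set"
  assumes "tunnel_gadget k P G"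
    and "\<not> interacting_tunnels P G"
  shows "motion_planning G \<in> NL"
  unfolding NL_def
proof (rule NSPACE_one_tapeI)
  fix x :: "('l, 's) letter list"
  show "x \<in> motion_planning G \<longleftrightarrow>
    (\<exists>i t h. (step1 (delta G) x)\<^sup>*\<^sup>* (Begin, 0, \<lambda>_. Blank, 0) (Acc, i, t, h))"
  proof
    assume "x \<in> motion_planning G"
    then obtain S where S: "x = encode S" "wf_system S" "solvable G S"
      by (auto simp: motion_planning_def)
    then show "\<exists>i t h. (step1 (delta G) x)\<^sup>*\<^sup>* (Begin, 0, \<lambda>_. Blank, 0) (Acc, i, t, h)"
      using run_accept solvable_imp_static_reach[OF assms] by blast
  next
    assume "\<exists>i t h. (step1 (delta G) x)\<^sup>*\<^sup>* (Begin, 0, \<lambda>_. Blank, 0) (Acc, i, t, h)"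
    then obtain i t h where "inv G x Acc i t h" using run_inv by blast
    then obtain S where "x = encode S" "wf_system S" "static_reach G S (goal_loc S)" by auto
    then show "x \<in> motion_planning G"
      using static_reach_imp_solvable[OF assms] by (auto simp: motion_planning_def)
  qed
next
  fix x :: "('l, 's) letter list" and q i t h
  assume "(step1 (delta G) x)\<^sup>*\<^sup>* (Begin, 0, \<lambda>_. Blank, 0) (q, i, t, h)"
  \<comment> \<open>The bound comes from the invariant, so it holds on every run, accepting or not,
    and also on words that encode nothing.\<close>
  then obtain n where n: "2 ^ n \<le> 2 * length x + 1" "h \<le> Suc n"
    using run_inv inv_space by blast
  have "real n \<le> log 2 (2 * real (length x) + 1)"
  proof -
    have "2 ^ n \<le> 2 * real (length x) + 1" using of_nat_mono[OF n(1), where 'a = real] by simp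
    then show ?thesis by (simp add: le_log_iff powr_realpow)
  qed
  then show "h < nat \<lfloor>log 2 (2 * real (length x) + 1)\<rfloor> + 2"
    using n(2) by linarith
qed (rule log_space_bound)

end
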